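(* Assume (L), (W), that $X$ is compact, and that the complement $(F(X^\star))^c$ of the set of stationary values is dense in $\mathbb R$. Let $x_k$ be generated by the model-based iteration $$x_{k+1}=\operatorname*{argmin}_{y\in X}\Big\{f_{x_k}(y;S_k)+\varphi(y)+\frac{1}{2\alpha_k}\|y-x_k\|^2\Big\},\qquad S_k\stackrel{\text{i.i.d.}}{\sim}P,$$ started from $x_0\in X$, where the models $f_x(\cdot;s)$ satisfy conditions (C.i)--(C.iv) and the stepsizes $\alpha_k>0$ satisfy $\sum_k\alpha_k=\infty$ and $\sum_k\alpha_k^2<\infty$. Then, with probability 1, $f(x_k)+\varphi(x_k)$ converges, and all cluster points of the sequence $\{x_k\}$ belong to $X^\star$.
   Context: Setting. $P$ is a probability distribution on a sample space $\mathcal S$, and $S\sim P$. $X\subset\mathbb R^d$ is a nonempty closed convex set and $\varphi:\mathbb R^d\to\mathbb R$ is a closed convex function. For each $s\in\mathcal S$, $f(\cdot;s):\mathbb R^d\to\mathbb R$; $f(x)=\mathbb E_P[f(x;S)]$ is finite for every $x\in\mathbb R^d$, and $F(x)=f(x)+\varphi(x)$. All functions of $s$ involved are measurable. $\|\cdot\|$ is the Euclidean norm and $\mathbb B$ the unit ball. For a function $h:\mathbb R^d\to\mathbb R\cup\{+\infty\}$, $\partial h(x)=\{g: h(y)\ge h(x)+\langle g,y-x\rangle+o(\|y-x\|)\text{ as }y\to x\}$ is the Fréchet subdifferential (the usual subdifferential for convex $h$). (L) With $M_\epsilon(x;s)=\sup_{y\in X,\|y-x\|\le\epsilon}\ \sup_{g\in\partial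 f(y;s)}\|g\|$, there is $\epsilon_0>0$ such that $0<\epsilon\le\epsilon_0$ implies $\mathbb E[M_\epsilon(x;S)^2]<\infty$ for all $x\in X$. (W) There is $\epsilon_0>0$ such that $0<\epsilon\le\epsilon_0$ implies that for all $x\in X$ there is $\lambda(s,x)\ge0$ such that $y\mapsto f(y;s)+\frac{\lambda(s,x)}2\|y-x_0\|^2$ is convex on $x+\epsilon\mathbb B$ for any $x_0\in\mathbb R^d$, and $\mathbb E[\lambda(S,x)]<\infty$. Models. For each $x\in X$ and $s\in\mathcal S$ one has a model $f_x(\cdot;s):\mathbb R^d\to\mathbb R\cup\{+\infty\}$ of $f(\cdot;s)$ at $x$; the argmin in the iteration is assumed attained (it is then unique) and measurable in $s$. Conditions: (C.i) $y\mapsto f_x(y;s)$ is convex and subdifferentiable on its domain. (C.ii) $f_x(x;s)=f(x;s)$. (C.iii) $\partial_y f_x(y;s)|_{y=x}\subset\partial f(x;s)$. (C.iv) There is $\epsilon_0>0$ such that $0<\epsilon\le\epsilon_0$ implies that for all $x_0\in X$ there is $\delta_\epsilon(x_0;s)\ge0$ with $f(y;s)\ge f_x(y;s)-\frac12\delta_\epsilon(x_0;s)\|y-x\|^2$ for all $x\in X\cap(x_0+\epsilon\mathbb B)$, $y\in x_0+\epsilon\mathbb B$, where $\mathbb E[\delta_\epsilon(x_0;S)]<\infty$. Stationary set: $X^\star=\{x\in X:\exists\, g\in\partial f(x)+\partial\varphi(x)\text{ with }\langle g,y-x\rangle\ge0\text{ for all }y\in X\}$, and $F(X^\star)=\{F(x):x\in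 X^\star\}$. *)

theory Defs
  imports "HOL-Probability.Probability" "HOL-Library.Landau_Symbols"
begin

(* Frechet subdifferential; it is empty at points where h is infinite. *)
definition frechet_subdiff :: "('a::euclidean_space \<Rightarrow> ereal) \<Rightarrow> 'a \<Rightarrow> 'a set" where
  "frechet_subdiff h x =
     {g. \<bar>h x\<bar> \<noteq> \<infinity> \<and>
         (\<exists>r::'a \<Rightarrow> real. r \<in> o[at x](\<lambda>y. norm (y - x)) \<and>
            (\<forall>\<^sub>F y in at x. h y \<ge> h x + ereal (g \<bullet> (y - x)) + ereal (r y)))}"

definition convex_ereal :: "('a::real_vector \<Rightarrow> ereal) \<Rightarrow> bool" where
  "convex_ereal h \<longleftrightarrow> convex {(y, r::real). h y \<le> ereal r}"

(* In what follows f y s is the sample loss f(y;s), and fm x s y is the value at y of the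
   model f_x(.;s) centred at x. *)

definition mean_loss :: "'s measure \<Rightarrow> ('a \<Rightarrow> 's \<Rightarrow> real) \<Rightarrow> 'a \<Rightarrow> real" where
  "mean_loss P f x = (\<integral>s. f x s \<partial>P)"

definition objective :: "'s measure \<Rightarrow> ('a \<Rightarrow> 's \<Rightarrow> real) \<Rightarrow> ('a \<Rightarrow> real) \<Rightarrow> 'a \<Rightarrow> real" where
  "objective P f \<phi> x = mean_loss P f x + \<phi> x"

definition local_lip ::
  "'a set \<Rightarrow> ('a::euclidean_space \<Rightarrow> 's \<Rightarrow> real) \<Rightarrow> real \<Rightarrow> 'a \<Rightarrow> 's \<Rightarrow> ennreal" where
  "local_lip X f \<epsilon> x s =
     (SUP y\<in>{y \<in> X. norm (y - x) \<le> \<epsilon>}.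
        SUP g\<in>frechet_subdiff (\<lambda>z. ereal (f z s)) y. ennreal (norm g))"

definition cond_L :: "'s measure \<Rightarrow> 'a set \<Rightarrow> ('a::euclidean_space \<Rightarrow> 's \<Rightarrow> real) \<Rightarrow> bool" where
  "cond_L P X f \<longleftrightarrow>
     (\<exists>\<epsilon>0>0. \<forall>\<epsilon>. 0 < \<epsilon> \<and> \<epsilon> \<le> \<epsilon>0 \<longrightarrow>
        (\<forall>x\<in>X. local_lip X f \<epsilon> x \<in> borel_measurable P \<and>
               (\<integral>\<^sup>+ s. (local_lip X f \<epsilon> x s)\<^sup>2 \<partial>P) < \<infinity>))"

definition cond_W :: "'s measure \<Rightarrow> 'a set \<Rightarrow> ('a::euclidean_space \<Rightarrow> 's \<Rightarrow> real) \<Rightarrow> bool" where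
  "cond_W P X f \<longleftrightarrow>
     (\<exists>\<epsilon>0>0. \<forall>\<epsilon>. 0 < \<epsilon> \<and> \<epsilon> \<le> \<epsilon>0 \<longrightarrow>
        (\<forall>x\<in>X. \<exists>lam :: 's \<Rightarrow> real. integrable P lam \<and>
           (\<forall>s\<in>space P. lam s \<ge> 0 \<and>
              (\<forall>x0. convex_on (cball x \<epsilon>) (\<lambda>y. f y s + lam s / 2 * (norm (y - x0))\<^sup>2)))))"

definition cond_C1 :: "'s measure \<Rightarrow> 'a set \<Rightarrow> ('a::euclidean_space \<Rightarrow> 's \<Rightarrow> 'a \<Rightarrow> ereal) \<Rightarrow> bool" where
  "cond_C1 P X fm \<longleftrightarrow>
     (\<forall>x\<in>X. \<forall>s\<in>space P. convex_ereal (fm x s) \<and>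
        (\<forall>y. fm x s y < \<infinity> \<longrightarrow> frechet_subdiff (fm x s) y \<noteq> {}))"

definition cond_C2 ::
  "'s measure \<Rightarrow> 'a set \<Rightarrow> ('a \<Rightarrow> 's \<Rightarrow> real) \<Rightarrow> ('a \<Rightarrow> 's \<Rightarrow> 'a \<Rightarrow> ereal) \<Rightarrow> bool" where
  "cond_C2 P X f fm \<longleftrightarrow> (\<forall>x\<in>X. \<forall>s\<in>space P. fm x s x = ereal (f x s))"

definition cond_C3 ::
  "'s measure \<Rightarrow> 'a set \<Rightarrow> ('a::euclidean_space \<Rightarrow> 's \<Rightarrow> real) \<Rightarrow> ('a \<Rightarrow> 's \<Rightarrow> 'a \<Rightarrow> ereal) \<Rightarrow> bool" where
  "cond_C3 P X f fm \<longleftrightarrow>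
     (\<forall>x\<in>X. \<forall>s\<in>space P.
        frechet_subdiff (fm x s) x \<subseteq> frechet_subdiff (\<lambda>y. ereal (f y s)) x)"

definition cond_C4 ::
  "'s measure \<Rightarrow> 'a set \<Rightarrow> ('a::euclidean_space \<Rightarrow> 's \<Rightarrow> real) \<Rightarrow> ('a \<Rightarrow> 's \<Rightarrow> 'a \<Rightarrow> ereal) \<Rightarrow> bool" where
  "cond_C4 P X f fm \<longleftrightarrow>
     (\<exists>\<epsilon>0>0. \<forall>\<epsilon>. 0 < \<epsilon> \<and> \<epsilon> \<le> \<epsilon>0 \<longrightarrow>
        (\<forall>x0\<in>X. \<exists>\<delta> :: 's \<Rightarrow> real. integrable P \<delta> \<and>
           (\<forall>s\<in>space P. \<delta> s \<ge> 0 \<and>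
              (\<forall>x\<in>X \<inter> cball x0 \<epsilon>. \<forall>y\<in>cball x0 \<epsilon>.
                 ereal (f y s) \<ge> fm x s y - ereal (1 / 2 * \<delta> s * (norm (y - x))\<^sup>2)))))"

definition stationary_set ::
  "'s measure \<Rightarrow> 'a set \<Rightarrow> ('a::euclidean_space \<Rightarrow> 's \<Rightarrow> real) \<Rightarrow> ('a \<Rightarrow> real) \<Rightarrow> 'a set" where
  "stationary_set P X f \<phi> =
     {x \<in> X. \<exists>g1 \<in> frechet_subdiff (\<lambda>y. ereal (mean_loss P f y)) x.
             \<exists>g2 \<in> frechet_subdiff (\<lambda>y. ereal (\<phi> y)) x.
             \<forall>y\<in>X. (g1 + g2) \<bullet> (y - x) \<ge> 0}"

(* S_0, S_1, ... are i.i.d. with law P, on an arbitrary probability space M. *)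
definition iid_samples :: "'w measure \<Rightarrow> 's measure \<Rightarrow> (nat \<Rightarrow> 'w \<Rightarrow> 's) \<Rightarrow> bool" where
  "iid_samples M P S \<longleftrightarrow>
     prob_space.indep_vars M (\<lambda>_. P) S UNIV \<and> (\<forall>k. distr M P (S k) = P)"

(* The sigma-algebra on the sample space of M generated by S_0, ..., S_(k-1). *)
definition past :: "'w measure \<Rightarrow> 's measure \<Rightarrow> (nat \<Rightarrow> 'w \<Rightarrow> 's) \<Rightarrow> nat \<Rightarrow> 'w measure" where
  "past M P S k =
     vimage_algebra (space M) (\<lambda>\<omega>. \<lambda>i\<in>{..<k}. S i \<omega>) (PiM {..<k} (\<lambda>_. P))"

(* The minimiser need not exist for every s, so the iteration is stated as a relation: x_(k+1)
   attains the minimum (which is unique by strong convexity of the minimised function).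
   Measurability of the argmin in the samples makes x_k a random variable determined
   measurably by S_0, ..., S_(k-1). *)
definition model_iteration ::
  "'w measure \<Rightarrow> 's measure \<Rightarrow> 'a set \<Rightarrow> ('a::euclidean_space \<Rightarrow> 's \<Rightarrow> 'a \<Rightarrow> ereal) \<Rightarrow> ('a \<Rightarrow> real)
    \<Rightarrow> (nat \<Rightarrow> real) \<Rightarrow> (nat \<Rightarrow> 'w \<Rightarrow> 's) \<Rightarrow> 'a \<Rightarrow> (nat \<Rightarrow> 'w \<Rightarrow> 'a) \<Rightarrow> bool" where
  "model_iteration M P X fm \<phi> \<alpha> S x0 x \<longleftrightarrow>
     (\<forall>\<omega>\<in>space M. x 0 \<omega> = x0) \<and>
     (\<forall>k. \<forall>\<omega>\<in>space M.
        is_arg_min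
          (\<lambda>y. fm (x k \<omega>) (S k \<omega>) y + ereal (\<phi> y)
               + ereal (1 / (2 * \<alpha> k) * (norm (y - x k \<omega>))\<^sup>2))
          (\<lambda>y. y \<in> X) (x (Suc k) \<omega>)) \<and>
     (\<forall>k. x k \<in> borel_measurable (past M P S k))"

end

theory Submission imports Defs begin

text \<open>Write \<open>F = f + \<phi>\<close> and, for a large constant \<open>\<rho>\<close>, let
\<open>e(x) = min {F(z) + \<rho>/2 |z - x|^2 | z \<in> X}\<close> be the Moreau envelope of \<open>F\<close> over \<open>X\<close>. The
method is a descent method for \<open>e\<close> in conditional mean, and the amount of descent is measured by
the gap \<open>D = F - e\<close>, which is nonnegative and continuous on \<open>X\<close>.

The descent comes from strong convexity. If \<open>v\<close> attains the minimum defining \<open>e(x)\<close>, then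
comparing the new iterate \<open>x'\<close> with \<open>v\<close> in the strongly convex subproblem, and using that the model
is at most \<open>f(v;s) + \<delta>(s)/2 |v - x|^2\<close> at \<open>v\<close>, bounds \<open>|v - x'|^2 - |v - x|^2\<close> by
\<open>2\<alpha>\<close> times \<open>f(v;s) - f(x;s) + \<phi>(v) - \<phi>(x) + \<delta>(s)/2 |v - x|^2\<close>, up to a term of order \<open>\<alpha>^2\<close>.
In the mean the bracket is \<open>F(v) - F(x) + E[\<delta>]/2 |v - x|^2\<close>, and since
\<open>F(v) + \<rho>/2 |v - x|^2 = e(x)\<close> this is at most \<open>-D(x)\<close> as soon as \<open>\<rho> \<ge> E[\<delta>]\<close>. Hence
\<open>E[e(x_(k+1)) | past] \<le> e(x_k) - \<rho> \<alpha>_k D(x_k) + C \<alpha>_k^2\<close> (lemma \<open>expected_decrease\<close>).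

A Robbins--Siegmund argument (\<open>robbins_siegmund_bounded\<close>, resting on the almost sure convergence of
\<open>L^2\<close> martingales) now yields, almost surely, that \<open>e(x_k)\<close> converges and
\<open>\<Sum> \<alpha>_k D(x_k)\<close> is finite. The steps have length at most \<open>\<alpha>_k (L(S_k) + K)\<close> with \<open>L(S_k)\<close> square
integrable, so the distance travelled is, up to a convergent noise term, a multiple of the elapsed
\<open>\<Sum> \<alpha>_k\<close>; were \<open>D(x_k)\<close> to climb above \<open>2c\<close> infinitely often, each descent from there to \<open>c\<close> would
use up a fixed amount of \<open>\<Sum> \<alpha>_k D(x_k)\<close>. So \<open>D(x_k)\<close> tends to zero (\<open>potential_tendsto_zero\<close>).

Therefore \<open>F(x_k) = e(x_k) + D(x_k)\<close> converges, and a cluster point \<open>z\<close> satisfies \<open>D(z) = 0\<close>,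
that is, \<open>z\<close> minimises \<open>F + \<rho>/2 |. - z|^2\<close> over \<open>X\<close>. As \<open>f\<close> is weakly convex near \<open>z\<close>, a single separation
argument splits this minimality into subgradients of \<open>f\<close> and \<open>\<phi>\<close> and the normal cone of \<open>X\<close>
(\<open>stationary_of_proximal_minimizer\<close>), so \<open>z\<close> is stationary.\<close>

section \<open>Convex functions and the proximal step\<close>

text \<open>Walk from \<open>x\<close> towards \<open>y\<close> on the segment: convexity makes the difference quotients at most
\<open>h y - h x\<close>, while the error term of the Frechet subgradient, divided by the step, vanishes.\<close>

lemma frechet_subgradient_convex_global:
  fixes h :: "'a::euclidean_space \<Rightarrow> ereal"
  assumes cvx: "convex_ereal h" and g: "g \<in> frechet_subdiff h x" and finite: "h y \<noteq> -\<infinity>"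
  shows "h y \<ge> h x + ereal (g \<bullet> (y - x))"
proof (cases "y = x \<or> h y = \<infinity>")
  case True
  then show ?thesis by auto
next
  case False
  then obtain b where b: "h y = ereal b" using finite by (cases "h y") auto
  from g obtain r where hx: "\<bar>h x\<bar> \<noteq> \<infinity>" and r: "r \<in> o[at x](\<lambda>y. norm (y - x))"
    and ev: "\<forall>\<^sub>F y in at x. h y \<ge> h x + ereal (g \<bullet> (y - x)) + ereal (r y)"
    unfolding frechet_subdiff_def by auto
  obtain a where a: "h x = ereal a" using hx by (cases "h x") auto
  define p where "p t = x + t *\<^sub>R (y - x)" for t :: real
  have p: "filterlim p (at x) (at_right 0)"
    unfolding filterlim_at
  proof
    show "\<forall>\<^sub>F t in at_right 0. p t \<in> UNIV \<and> p t \<noteq> x"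
      using False by (auto simp: p_def eventually_at_right_less intro!: eventually_mono[OF eventually_at_right_less])
    have "(p \<longlongrightarrow> x + 0 *\<^sub>R (y - x)) (at_right 0)"
      unfolding p_def by (intro tendsto_intros)
    then show "(p \<longlongrightarrow> x) (at_right 0)" by simp
  qed
  have "((\<lambda>z. r z / norm (z - x)) \<longlongrightarrow> 0) (at x)"
    using smalloD_tendsto[OF r] .
  from filterlim_compose[OF this p]
  have "((\<lambda>t. r (p t) / norm (p t - x)) \<longlongrightarrow> 0) (at_right 0)" .
  then have "((\<lambda>t. r (p t) / norm (p t - x) * norm (y - x)) \<longlongrightarrow> 0 * norm (y - x)) (at_right 0)"
    by (intro tendsto_mult tendsto_const)
  then have lim: "((\<lambda>t. g \<bullet> (y - x) + r (p t) / norm (p t - x) * norm (y - x)) \<longlongrightarrow> g \<bullet> (y - x) + 0) (at_right 0)"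
    by (intro tendsto_add tendsto_const) simp
  have ev': "\<forall>\<^sub>F t in at_right 0. h (p t) \<ge> h x + ereal (g \<bullet> (p t - x)) + ereal (r (p t))"
    using ev p by (auto simp: filterlim_iff)
  have "\<forall>\<^sub>F t in at_right (0::real). t < 1"
    by (rule order_tendstoD[OF tendsto_ident_at]) simp
  with ev' eventually_at_right_less[of 0]
  have "\<forall>\<^sub>F t in at_right 0. b - a \<ge> g \<bullet> (y - x) + r (p t) / norm (p t - x) * norm (y - x)"
  proof eventually_elim
    case (elim t)
    have "(x, a) \<in> {(y, r::real). h y \<le> ereal r}" "(y, b) \<in> {(y, r::real). h y \<le> ereal r}"
      using a b by auto
    then have "(1 - t) *\<^sub>R (x, a) + t *\<^sub>R (y, b) \<in> {(y, r::real). h y \<le> ereal r}"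
      using cvx elim unfolding convex_ereal_def by (intro convexD) auto
    then have "h (p t) \<le> ereal ((1 - t) * a + t * b)"
      by (simp add: p_def algebra_simps)
    with elim(1) a have "ereal (a + g \<bullet> (p t - x) + r (p t)) \<le> ereal ((1 - t) * a + t * b)"
      using order_trans by fastforce
    then have "t * (g \<bullet> (y - x)) + r (p t) \<le> t * (b - a)"
      by (simp add: p_def algebra_simps)
    then have "(t * (g \<bullet> (y - x)) + r (p t)) / t \<le> b - a"
      using elim by (simp add: pos_divide_le_eq mult.commute)
    moreover have "(t * (g \<bullet> (y - x)) + r (p t)) / t = g \<bullet> (y - x) + r (p t) / t"
      using elim by (simp add: add_divide_distrib)
    moreover have "r (p t) / norm (p t - x) * norm (y - x) = r (p t) / t"
      using elim False by (simp add: p_def)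
    ultimately show ?case by simp
  qed
  then have "g \<bullet> (y - x) + 0 \<le> b - a"
    by (intro tendsto_le[OF _ tendsto_const lim]) (auto simp: trivial_limit_at_right_real)
  then show ?thesis using a b by simp
qed

text \<open>Prolong the segment from \<open>y\<close> to \<open>x\<close> by length one beyond \<open>x\<close>, to a point \<open>w\<close>. The slope of \<open>h\<close>
between \<open>y\<close> and \<open>x\<close> is at most \<open>h w - h x\<close>, and \<open>h\<close> is bounded on the ball that contains all such \<open>w\<close>.\<close>

lemma convex_on_imp_lower_lipschitz_on_bounded:
  fixes h :: "'a::euclidean_space \<Rightarrow> real"
  assumes cvx: "convex_on UNIV h" and bd: "bounded X"
  obtains L where "L \<ge> 0" "\<And>x y. x \<in> X \<Longrightarrow> y \<in> X \<Longrightarrow> h x - h y \<le> L * norm (x - y)"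
proof -
  obtain R where R: "\<And>x. x \<in> X \<Longrightarrow> norm x \<le> R"
    using bd unfolding bounded_iff by auto
  have "continuous_on (cball 0 (R + 1)) h"
    using convex_on_continuous[OF open_UNIV cvx] continuous_on_subset by blast
  then have "bounded (h ` cball 0 (R + 1))"
    by (intro compact_imp_bounded compact_continuous_image compact_cball)
  then obtain B where B: "\<And>x. norm x \<le> R + 1 \<Longrightarrow> \<bar>h x\<bar> \<le> B"
    unfolding bounded_iff by (force simp: mem_cball_0)
  show thesis
  proof (rule that[of "2 * \<bar>B\<bar>"])
    fix x y assume xy: "x \<in> X" "y \<in> X"
    show "h x - h y \<le> 2 * \<bar>B\<bar> * norm (x - y)"
    proof (cases "x = y")
      case False
      define t where "t = norm (x - y)"
      have t: "t > 0" using False by (simp add: t_def)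
      define w where "w = x + (1 / t) *\<^sub>R (x - y)"
      have nw: "norm w \<le> R + 1"
        unfolding w_def using norm_triangle_ineq[of x "(1 / t) *\<^sub>R (x - y)"] R[OF xy(1)] t
        by (simp add: t_def)
      have "(1 + t) *\<^sub>R x = y + t *\<^sub>R w"
        using t by (simp add: w_def algebra_simps)
      then have "x = (1 / (1 + t)) *\<^sub>R (y + t *\<^sub>R w)"
        using t by (metis add_pos_pos divide_self_if less_numeral_extra(1,3) mult.commute
            real_scaleR_def scaleR_one scaleR_scaleR times_divide_eq_left mult_1)
      then have xe: "x = (1 / (1 + t)) *\<^sub>R y + (t / (1 + t)) *\<^sub>R w"
        by (simp add: algebra_simps)
      have "h x \<le> (1 / (1 + t)) * h y + (t / (1 + t)) * h w"
      proof -
        have "1 - t / (1 + t) = 1 / (1 + t)" using t by (simp add: field_simps)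
        then show ?thesis
          using convex_onD[OF cvx, of "t / (1 + t)" y w] t xe by simp
      qed
      then have "(1 + t) * h x \<le> (1 + t) * ((1 / (1 + t)) * h y + (t / (1 + t)) * h w)"
        using t by (intro mult_left_mono) auto
      also have "\<dots> = h y + t * h w"
        using t by (simp add: distrib_left)
      finally have "(1 + t) * h x \<le> h y + t * h w" .
      then have "h x - h y \<le> t * (h w - h x)" by (simp add: algebra_simps)
      also have "\<dots> \<le> t * (2 * \<bar>B\<bar>)"
        using t B[OF nw] B[of x] R[OF xy(1)] by (intro mult_left_mono) auto
      finally show ?thesis by (simp add: t_def mult.commute)
    qed simp
  qed simp
qed

lemma norm_power2_convex_combination:
  fixes p z x :: "'a::real_inner"
  shows "(norm ((1 - t) *\<^sub>R p + t *\<^sub>R z - x))\<^sup>2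
    = (1 - t) * (norm (p - x))\<^sup>2 + t * (norm (z - x))\<^sup>2 - t * (1 - t) * (norm (z - p))\<^sup>2"
  unfolding power2_norm_eq_inner
  by (simp add: inner_diff_left inner_diff_right inner_add_left inner_add_right inner_commute algebra_simps)

text \<open>The minimised function is strongly convex with modulus \<open>1/\<alpha>\<close>, so it grows quadratically away from
its minimiser \<open>p\<close>. The growth is obtained by comparing \<open>p\<close> with the points
\<open>(1 - t) p + t z\<close> and letting \<open>t\<close> tend to zero.\<close>

lemma proximal_three_point:
  fixes m :: "'a::euclidean_space \<Rightarrow> ereal"
  assumes X: "convex X" and cvx: "convex_ereal m" and proper: "\<And>z. m z \<noteq> -\<infinity>"
    and \<phi>: "convex_on UNIV \<phi>" and \<alpha>: "\<alpha> > 0" and p: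
      "is_arg_min (\<lambda>y. m y + ereal (\<phi> y) + ereal (1 / (2 * \<alpha>) * (norm (y - x))\<^sup>2)) (\<lambda>y. y \<in> X) p"
    and z: "z \<in> X" "m z \<le> ereal c"
  shows "m p + ereal (\<phi> p + 1 / (2 * \<alpha>) * (norm (p - x))\<^sup>2 + 1 / (2 * \<alpha>) * (norm (z - p))\<^sup>2)
    \<le> ereal (c + \<phi> z + 1 / (2 * \<alpha>) * (norm (z - x))\<^sup>2)"
proof -
  define q where "q y = 1 / (2 * \<alpha>) * (norm (y - x))\<^sup>2" for y
  have pX: "p \<in> X" and pmin: "\<And>y. y \<in> X \<Longrightarrow> m p + ereal (\<phi> p) + ereal (q p) \<le> m y + ereal (\<phi> y) + ereal (q y)"
    using p unfolding is_arg_min_def q_def by (auto simp: not_less)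
  obtain b where b: "m p = ereal b"
    using pmin[OF z(1)] z(2) proper[of p] by (cases "m p"; cases "m z") auto
  have "\<forall>\<^sub>F t in at_right (0::real). t < 1"
    by (rule order_tendstoD[OF tendsto_ident_at]) simp
  with eventually_at_right_less[of 0]
  have "\<forall>\<^sub>F t in at_right 0. b + \<phi> p + q p + (1 - t) * (1 / (2 * \<alpha>) * (norm (z - p))\<^sup>2) \<le> c + \<phi> z + q z"
  proof eventually_elim
    case (elim t)
    define w where "w = (1 - t) *\<^sub>R p + t *\<^sub>R z"
    have "(p, b) \<in> {(y, r::real). m y \<le> ereal r}" "(z, c) \<in> {(y, r::real). m y \<le> ereal r}"
      using b z by auto
    then have "(1 - t) *\<^sub>R (p, b) + t *\<^sub>R (z, c) \<in> {(y, r::real). m y \<le> ereal r}"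
      using cvx elim unfolding convex_ereal_def by (intro convexD) auto
    then have mw: "m w \<le> ereal ((1 - t) * b + t * c)"
      by (simp add: w_def)
    have wX: "w \<in> X" unfolding w_def using X pX z elim by (intro convexD) auto
    have fw: "\<phi> w \<le> (1 - t) * \<phi> p + t * \<phi> z"
      unfolding w_def using elim by (intro convex_onD[OF \<phi>]) auto
    have qw: "q w = (1 - t) * q p + t * q z - t * ((1 - t) * (1 / (2 * \<alpha>) * (norm (z - p))\<^sup>2))"
      unfolding q_def w_def norm_power2_convex_combination using \<alpha> by (simp add: field_simps)
    have "ereal (b + \<phi> p + q p) \<le> m w + ereal (\<phi> w) + ereal (q w)"
      using pmin[OF wX] b by simp
    also have "\<dots> \<le> ereal ((1 - t) * b + t * c) + ereal (\<phi> w) + ereal (q w)"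
      using mw by (intro add_right_mono)
    finally have "b + \<phi> p + q p \<le> ((1 - t) * b + t * c) + \<phi> w + q w" by simp
    with fw qw have "t * (b + \<phi> p + q p + (1 - t) * (1 / (2 * \<alpha>) * (norm (z - p))\<^sup>2)) \<le> t * (c + \<phi> z + q z)"
      by (simp add: algebra_simps)
    then show ?case using elim by simp
  qed
  moreover have "((\<lambda>t. b + \<phi> p + q p + (1 - t) * (1 / (2 * \<alpha>) * (norm (z - p))\<^sup>2))
      \<longlongrightarrow> b + \<phi> p + q p + (1 - 0) * (1 / (2 * \<alpha>) * (norm (z - p))\<^sup>2)) (at_right 0)"
    by (intro tendsto_intros)
  ultimately have "b + \<phi> p + q p + (1 - 0) * (1 / (2 * \<alpha>) * (norm (z - p))\<^sup>2) \<le> c + \<phi> z + q z"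
    by (intro tendsto_le[OF _ tendsto_const]) (auto simp: trivial_limit_at_right_real)
  then show ?thesis using b by (simp add: q_def)
qed

text \<open>The two facts that a single step provides. Comparison of the minimiser \<open>p\<close> with the centre \<open>x\<close> bounds
the step length. Comparison with another point \<open>z\<close> bounds how much farther from \<open>z\<close> the step can end
than it began; the terms linear in the step length \<open>n\<close> are absorbed by
\<open>2 n \<alpha> (L + K) \<le> n^2 + \<alpha>^2 (L + K)^2\<close>.\<close>

lemma model_step_bounds:
  fixes m :: "'a::euclidean_space \<Rightarrow> ereal"
  assumes X: "convex X" and cvx: "convex_ereal m" and proper: "\<And>z. m z \<noteq> -\<infinity>"
    and \<phi>: "convex_on UNIV \<phi>" and \<alpha>: "\<alpha> > 0" and p:
      "is_arg_min (\<lambda>y. m y + ereal (\<phi> y) + ereal (1 / (2 * \<alpha>) * (norm (y - x))\<^sup>2)) (\<lambda>y. y \<in> X) p"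
    and x: "x \<in> X" "m x = ereal a" and lower: "\<And>y. m y \<ge> ereal (a - L * norm (y - x))"
    and lip: "\<And>y. y \<in> X \<Longrightarrow> \<phi> x - \<phi> y \<le> K * norm (y - x)" and LK: "0 \<le> L + K"
  shows model_step_length: "norm (p - x) \<le> \<alpha> * (L + K)"
    and model_step_distance: "z \<in> X \<Longrightarrow> m z \<le> ereal c \<Longrightarrow>
      (norm (z - p))\<^sup>2 \<le> (norm (z - x))\<^sup>2 + 2 * \<alpha> * (c - a + \<phi> z - \<phi> x) + \<alpha>\<^sup>2 * (L + K)\<^sup>2"
proof -
  have pX: "p \<in> X" using p unfolding is_arg_min_def by auto
  define n where "n = norm (p - x)"
  have key: "2 * \<alpha> * (a - L * n + (\<phi> x - K * n)) + n\<^sup>2 + (norm (z - p))\<^sup>2 \<le> 2 * \<alpha> * (c + \<phi> z) + (norm (z - x))\<^sup>2"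
    if "z \<in> X" "m z \<le> ereal c" for z c
  proof -
    have "ereal (a - L * n) + ereal (\<phi> p + 1 / (2 * \<alpha>) * n\<^sup>2 + 1 / (2 * \<alpha>) * (norm (z - p))\<^sup>2)
      \<le> m p + ereal (\<phi> p + 1 / (2 * \<alpha>) * n\<^sup>2 + 1 / (2 * \<alpha>) * (norm (z - p))\<^sup>2)"
      using lower[of p] unfolding n_def by (intro add_right_mono)
    also have "\<dots> \<le> ereal (c + \<phi> z + 1 / (2 * \<alpha>) * (norm (z - x))\<^sup>2)"
      unfolding n_def by (rule proximal_three_point[OF X cvx proper \<phi> \<alpha> p that])
    finally have "a - L * n + \<phi> p + 1 / (2 * \<alpha>) * n\<^sup>2 + 1 / (2 * \<alpha>) * (norm (z - p))\<^sup>2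
      \<le> c + \<phi> z + 1 / (2 * \<alpha>) * (norm (z - x))\<^sup>2" by (simp add: add.assoc)
    from mult_left_mono[OF this, of "2 * \<alpha>"]
    have "2 * \<alpha> * (a - L * n + \<phi> p) + n\<^sup>2 + (norm (z - p))\<^sup>2 \<le> 2 * \<alpha> * (c + \<phi> z) + (norm (z - x))\<^sup>2"
      using \<alpha> by (simp add: algebra_simps)
    moreover have "2 * \<alpha> * (\<phi> x - K * n) \<le> 2 * \<alpha> * \<phi> p"
      using lip[OF pX] \<alpha> unfolding n_def by (intro mult_left_mono) auto
    ultimately show ?thesis by (simp add: algebra_simps)
  qed
  have "2 * n * n \<le> 2 * n * (\<alpha> * (L + K))"
    using key[OF x(1), of a] x(2) by (simp add: n_def norm_minus_commute[of x p] power2_eq_square algebra_simps)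
  moreover have "0 \<le> n" by (simp add: n_def)
  moreover have "0 \<le> \<alpha> * (L + K)" using \<alpha> LK by simp
  ultimately show "norm (p - x) \<le> \<alpha> * (L + K)"
    unfolding n_def[symmetric] by (cases "n = 0") (simp_all add: mult_le_cancel_left)
  show "(norm (z - p))\<^sup>2 \<le> (norm (z - x))\<^sup>2 + 2 * \<alpha> * (c - a + \<phi> z - \<phi> x) + \<alpha>\<^sup>2 * (L + K)\<^sup>2"
    if "z \<in> X" "m z \<le> ereal c"
    using key[OF that] zero_le_power2[of "n - \<alpha> * (L + K)"]
    by (simp add: power2_eq_square algebra_simps)
qed

section \<open>Stationarity from proximal minimality\<close>

lemma convex_on_norm_power2: "convex_on UNIV (\<lambda>y::'a::real_inner. (norm (y - z))\<^sup>2)"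
proof (rule convex_onI)
  fix t :: real and x y :: 'a
  assume t: "0 < t" "t < 1"
  show "(norm ((1 - t) *\<^sub>R x + t *\<^sub>R y - z))\<^sup>2
      \<le> (1 - t) * (norm (x - z))\<^sup>2 + t * (norm (y - z))\<^sup>2"
    unfolding norm_power2_convex_combination using t by simp
qed simp

lemma frechet_subdiffI_quadratic:
  fixes F :: "'a::euclidean_space \<Rightarrow> real"
  assumes "\<epsilon> > 0" and low: "\<And>y. y \<in> cball z \<epsilon> \<Longrightarrow> F y \<ge> F z + g \<bullet> (y - z) - c * (norm (y - z))\<^sup>2"
  shows "g \<in> frechet_subdiff (\<lambda>y. ereal (F y)) z"
proof -
  have "((\<lambda>y. norm (y - z)) \<longlongrightarrow> norm (z - z)) (at z)"
    by (intro tendsto_intros)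
  then have "((\<lambda>y. - c * norm (y - z)) \<longlongrightarrow> - c * 0) (at z)"
    by (intro tendsto_mult tendsto_const) simp
  moreover have "\<forall>\<^sub>F y in at z. - c * (norm (y - z))\<^sup>2 / norm (y - z) = - c * norm (y - z)"
    unfolding eventually_at_filter by (auto simp: power2_eq_square)
  ultimately have "((\<lambda>y. - c * (norm (y - z))\<^sup>2 / norm (y - z)) \<longlongrightarrow> 0) (at z)"
    by (subst tendsto_cong) auto
  then have "(\<lambda>y. - c * (norm (y - z))\<^sup>2) \<in> o[at z](\<lambda>y. norm (y - z))"
    by (intro smalloI_tendsto) (auto simp: eventually_at_filter)
  moreover have "\<forall>\<^sub>F y in at z. ereal (F y) \<ge> ereal (F z) + ereal (g \<bullet> (y - z)) + ereal (- c * (norm (y - z))\<^sup>2)"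
  proof -
    have "\<forall>\<^sub>F y in at z. y \<in> cball z \<epsilon>"
      using \<open>\<epsilon> > 0\<close> by (auto simp: eventually_at dist_commute intro!: exI[of _ \<epsilon>])
    then show ?thesis
      by eventually_elim (use low in auto)
  qed
  ultimately show ?thesis
    unfolding frechet_subdiff_def mem_Collect_eq
    by (intro conjI exI[of _ "\<lambda>y. - c * (norm (y - z))\<^sup>2"]) simp
qed

text \<open>The sum rule for subdifferentials together with the normal cone of \<open>X\<close>, in one separation. With
\<open>u = F + c |. - z|^2\<close> convex near \<open>z\<close>, give \<open>F\<close>, \<open>\<phi>\<close> and the constraint independent arguments
\<open>y\<close>, \<open>w\<close>, \<open>v\<close>; the set \<open>C\<close> of all \<open>(y - v, w - v, t)\<close> with
\<open>t > u(y) + \<phi>(w) - u(z) - \<phi>(z)\<close> is convex, and it misses the origin because \<open>z\<close> minimises \<open>u + \<phi>\<close>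
among the common points \<open>y = w = v\<close>. The normal of a hyperplane separating \<open>C\<close> from the origin
contains both subgradients, and freezing two of the three arguments at \<open>z\<close> gives the three claims.\<close>

lemma stationary_of_proximal_minimizer:
  fixes F \<phi> :: "'a::euclidean_space \<Rightarrow> real"
  assumes X: "convex X" and z: "z \<in> X" and \<epsilon>: "\<epsilon> > 0"
    and F: "convex_on (cball z \<epsilon>) (\<lambda>y. F y + l / 2 * (norm (y - z))\<^sup>2)"
    and \<phi>: "convex_on UNIV \<phi>"
    and min: "\<And>y. y \<in> X \<Longrightarrow> F z + \<phi> z \<le> F y + \<phi> y + \<rho> / 2 * (norm (y - z))\<^sup>2"
  shows "\<exists>g1\<in>frechet_subdiff (\<lambda>y. ereal (F y)) z. \<exists>g2\<in>frechet_subdiff (\<lambda>y. ereal (\<phi> y)) z.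
           \<forall>y\<in>X. (g1 + g2) \<bullet> (y - z) \<ge> 0"
proof -
  \<comment> \<open>The weight must make \<open>u\<close> convex (\<open>l / 2\<close>) and also dominate the quadratic slack in \<open>min\<close> (\<open>\<rho> / 2\<close>).\<close>
  define c where "c = max l \<rho> / 2"
  define u where "u y = F y + c * (norm (y - z))\<^sup>2" for y
  define B where "B = cball z \<epsilon>"
  have zB: "z \<in> B" using \<epsilon> by (simp add: B_def)
  have uz: "u z = F z" by (simp add: u_def)
  have cu: "convex_on B u"
  proof -
    have "convex_on B (\<lambda>y. (F y + l / 2 * (norm (y - z))\<^sup>2) + (c - l / 2) * (norm (y - z))\<^sup>2)"
      unfolding B_def using convex_on_subset[OF convex_on_norm_power2]
      by (intro convex_on_add F convex_on_cmul) (auto simp: c_def)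
    then show ?thesis unfolding u_def by (simp add: algebra_simps)
  qed
  define C where "C = {(y - v, w - v, t) | y w v t. y \<in> B \<and> w \<in> B \<and> v \<in> X \<and> u y + \<phi> w - u z - \<phi> z < t}"
  have CI: "(y - v, w - v, t) \<in> C" if "y \<in> B" "w \<in> B" "v \<in> X" "u y + \<phi> w - u z - \<phi> z < t" for y w v t
    unfolding C_def by (intro CollectI exI conjI) (rule refl that)+
  have "convex C"
    unfolding convex_alt
  proof (intro ballI allI impI)
    fix a b and s :: real assume "a \<in> C" "b \<in> C" and s: "0 \<le> s \<and> s \<le> 1"
    then obtain y w v t y' w' v' t' where
      a: "a = (y - v, w - v, t)" "y \<in> B" "w \<in> B" "v \<in> X" "u y + \<phi> w - u z - \<phi> z < t" and
      b: "b = (y' - v', w' - v', t')" "y' \<in> B" "w' \<in> B" "v' \<in> X" "u y' + \<phi> w' - u z - \<phi> z < t'"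
      unfolding C_def by auto
    let ?m = "\<lambda>p q. (1 - s) *\<^sub>R p + s *\<^sub>R q"
    have "?m y y' \<in> B" "?m w w' \<in> B" "?m v v' \<in> X"
      using a b s X convex_cball[of z \<epsilon>] unfolding convex_alt B_def by auto
    moreover have "u (?m y y') + \<phi> (?m w w') - u z - \<phi> z < (1 - s) * t + s * t'"
    proof -
      have "u (?m y y') \<le> (1 - s) * u y + s * u y'"
        using s a b by (intro convex_onD[OF cu]) auto
      moreover have "\<phi> (?m w w') \<le> (1 - s) * \<phi> w + s * \<phi> w'"
        using s by (intro convex_onD[OF \<phi>]) auto
      moreover have "(1 - s) * (u y + \<phi> w - u z - \<phi> z) + s * (u y' + \<phi> w' - u z - \<phi> z) < (1 - s) * t + s * t'"
      proof (cases "s = 0")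
        case False
        then show ?thesis using s a(5) b(5) by (intro add_le_less_mono mult_left_mono mult_strict_left_mono) auto
      qed (use a in simp)
      ultimately show ?thesis by (simp add: algebra_simps)
    qed
    moreover have "?m a b = (?m y y' - ?m v v', ?m w w' - ?m v v', (1 - s) * t + s * t')"
      by (simp add: a(1) b(1) algebra_simps)
    ultimately show "?m a b \<in> C" using CI by simp
  qed
  moreover have "0 \<notin> C"
  proof
    assume "0 \<in> C"
    then obtain v where v: "v \<in> X" "u v + \<phi> v - u z - \<phi> z < 0"
      unfolding C_def by (auto simp: zero_prod_def)
    have "\<rho> / 2 * (norm (v - z))\<^sup>2 \<le> c * (norm (v - z))\<^sup>2"
      by (intro mult_right_mono) (auto simp: c_def)
    with min[OF v(1)] v(2) show False by (simp add: u_def)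
  qed
  ultimately have "\<exists>p. p \<noteq> 0 \<and> (\<forall>x\<in>C. 0 \<le> p \<bullet> x)"
    by (rule separating_hyperplane_set_0)
  then obtain p where p0: "p \<noteq> 0" and p: "\<And>x. x \<in> C \<Longrightarrow> 0 \<le> p \<bullet> x"
    by auto
  obtain a b r where pe: "p = (a, b, r)" by (cases p)
  have sep: "0 \<le> a \<bullet> (y - v) + b \<bullet> (w - v) + r * t"
    if "y \<in> B" "w \<in> B" "v \<in> X" "u y + \<phi> w - u z - \<phi> z < t" for y w v t
    using p[OF CI[OF that]] unfolding pe by (simp add: add.assoc)
  have r0: "0 \<le> r" using sep[OF zB zB z, of 1] by simp
  \<comment> \<open>The hyperplane is not vertical, because \<open>y\<close> and \<open>w\<close> range over full neighbourhoods of \<open>z\<close>.\<close>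
  have "r \<noteq> 0"
  proof
    assume r: "r = 0"
    have "e = 0" if "\<And>y. y \<in> B \<Longrightarrow> 0 \<le> e \<bullet> (y - z)" for e :: 'a
    proof (rule ccontr)
      assume e: "e \<noteq> 0"
      have "0 \<le> e \<bullet> (- ((\<epsilon> / norm e) *\<^sub>R e))"
        using that[of "z - (\<epsilon> / norm e) *\<^sub>R e"] e \<epsilon> by (simp add: B_def dist_norm)
      then have "e \<bullet> e \<le> 0"
        using e \<epsilon> by (simp add: field_simps mult_le_0_iff zero_le_mult_iff)
      with e show False using inner_gt_zero_iff[of e] by linarith
    qed
    moreover have "0 \<le> a \<bullet> (y - z)" if "y \<in> B" for y
      using sep[OF that zB z, of "u y + \<phi> z - u z - \<phi> z + 1"] r by simp
    moreover have "0 \<le> b \<bullet> (y - z)" if "y \<in> B" for y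
      using sep[OF zB that z, of "u z + \<phi> y - u z - \<phi> z + 1"] r by simp
    ultimately have "a = 0" "b = 0" by blast+
    with r pe p0 show False by (simp add: zero_prod_def)
  qed
  with r0 have r: "r > 0" by simp
  define g1 where "g1 = - (1 / r) *\<^sub>R a"
  define g2 where "g2 = - (1 / r) *\<^sub>R b"
  have main: "g1 \<bullet> (y - v) + g2 \<bullet> (w - v) \<le> u y + \<phi> w - u z - \<phi> z"
    if "y \<in> B" "w \<in> B" "v \<in> X" for y w v
  proof (rule dense_ge)
    fix t assume "u y + \<phi> w - u z - \<phi> z < t"
    from sep[OF that this] r show "g1 \<bullet> (y - v) + g2 \<bullet> (w - v) \<le> t"
      unfolding g1_def g2_def by (simp add: field_simps)
  qed
  have "g1 \<in> frechet_subdiff (\<lambda>y. ereal (F y)) z"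
    using main[OF _ zB z] by (intro frechet_subdiffI_quadratic[OF \<epsilon>, where c=c]) (auto simp: u_def B_def algebra_simps)
  moreover have "g2 \<in> frechet_subdiff (\<lambda>y. ereal (\<phi> y)) z"
    using main[OF zB _ z] by (intro frechet_subdiffI_quadratic[OF \<epsilon>, where c=0]) (auto simp: B_def algebra_simps)
  moreover have "(g1 + g2) \<bullet> (y - z) \<ge> 0" if "y \<in> X" for y
    using main[OF zB zB that] by (simp add: inner_diff_right inner_add_left)
  ultimately show ?thesis by blast
qed

section \<open>The Moreau envelope over a compact set\<close>

definition prox :: "('a::euclidean_space \<Rightarrow> real) \<Rightarrow> 'a set \<Rightarrow> real \<Rightarrow> 'a \<Rightarrow> 'a" where
  "prox F X \<rho> x = (SOME v. v \<in> X \<and> (\<forall>z\<in>X. F v + \<rho> / 2 * (norm (v - x))\<^sup>2 \<le> F z + \<rho> / 2 * (norm (z - x))\<^sup>2))"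

definition envelope :: "('a::euclidean_space \<Rightarrow> real) \<Rightarrow> 'a set \<Rightarrow> real \<Rightarrow> 'a \<Rightarrow> real" where
  "envelope F X \<rho> x = F (prox F X \<rho> x) + \<rho> / 2 * (norm (prox F X \<rho> x - x))\<^sup>2"

lemma
  assumes X: "compact X" "X \<noteq> {}" and F: "continuous_on X F"
  shows prox_in: "prox F X \<rho> x \<in> X"
    and envelope_le: "z \<in> X \<Longrightarrow> envelope F X \<rho> x \<le> F z + \<rho> / 2 * (norm (z - x))\<^sup>2"
proof -
  have "continuous_on X (\<lambda>z. F z + \<rho> / 2 * (norm (z - x))\<^sup>2)"
    by (intro continuous_intros F)
  from continuous_attains_inf[OF X this]
  have "\<exists>v. v \<in> X \<and> (\<forall>z\<in>X. F v + \<rho> / 2 * (norm (v - x))\<^sup>2 \<le> F z + \<rho> / 2 * (norm (z - x))\<^sup>2)"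
    by blast
  from someI_ex[OF this]
  have "prox F X \<rho> x \<in> X \<and> (\<forall>z\<in>X. envelope F X \<rho> x \<le> F z + \<rho> / 2 * (norm (z - x))\<^sup>2)"
    unfolding prox_def[symmetric] envelope_def .
  then show "prox F X \<rho> x \<in> X" "z \<in> X \<Longrightarrow> envelope F X \<rho> x \<le> F z + \<rho> / 2 * (norm (z - x))\<^sup>2"
    by auto
qed

lemma norm_power2_diff_le:
  fixes v x y :: "'a::real_normed_vector"
  assumes "norm (v - x) \<le> \<Delta>" "norm (v - y) \<le> \<Delta>"
  shows "(norm (v - x))\<^sup>2 \<le> (norm (v - y))\<^sup>2 + 2 * \<Delta> * norm (x - y)"
proof -
  have "norm (v - x) - norm (v - y) \<le> norm (x - y)"
    using norm_triangle_ineq2[of "v - x" "v - y"] by (simp add: norm_minus_commute)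
  then have "(norm (v - x) - norm (v - y)) * (norm (v - x) + norm (v - y)) \<le> norm (x - y) * (norm (v - x) + norm (v - y))"
    by (intro mult_right_mono) auto
  also have "\<dots> \<le> norm (x - y) * (2 * \<Delta>)"
    using assms by (intro mult_left_mono) auto
  finally show ?thesis by (simp add: power2_eq_square algebra_simps)
qed

lemma envelope_lipschitz:
  assumes X: "compact X" "X \<noteq> {}" and F: "continuous_on X F" and \<rho>: "\<rho> \<ge> 0"
    and diam: "\<And>x y. x \<in> X \<Longrightarrow> y \<in> X \<Longrightarrow> norm (x - y) \<le> \<Delta>" and xy: "x \<in> X" "y \<in> X"
  shows "\<bar>envelope F X \<rho> x - envelope F X \<rho> y\<bar> \<le> \<rho> * \<Delta> * norm (x - y)"
proof -
  have "envelope F X \<rho> x \<le> envelope F X \<rho> y + \<rho> * \<Delta> * norm (x - y)" if "x \<in> X" "y \<in> X" for x y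
  proof -
    let ?v = "prox F X \<rho> y"
    have v: "?v \<in> X" by (rule prox_in[OF X F])
    have "envelope F X \<rho> x \<le> F ?v + \<rho> / 2 * (norm (?v - x))\<^sup>2"
      by (rule envelope_le[OF X F v])
    also have "\<dots> \<le> F ?v + \<rho> / 2 * ((norm (?v - y))\<^sup>2 + 2 * \<Delta> * norm (x - y))"
      using \<rho> by (intro add_left_mono mult_left_mono norm_power2_diff_le diam v that) auto
    finally show ?thesis by (simp add: envelope_def algebra_simps)
  qed
  from this[of x y] this[of y x] xy show ?thesis by (auto simp: norm_minus_commute abs_le_iff)
qed

section \<open>Finite covers and nets\<close>

lemma compact_finite_ball_cover:
  fixes X :: "'a::metric_space set"
  assumes X: "compact X" and r: "r > 0"
  obtains U where "finite U" "U \<subseteq> X" "X \<subseteq> (\<Union>u\<in>U. ball u r)"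
proof (rule compactE_image[OF X, of X "\<lambda>u. ball u r"])
  show "X \<subseteq> (\<Union>u\<in>X. ball u r)" using r by auto
qed (use that in blast)+

text \<open>Iterates are replaced by nearby points of a finite set, so that random functions only have to be
evaluated at finitely many fixed points. In this way a bound on the conditional expectation of
\<open>f (x_k) (S_k)\<close> uses measurability of \<open>f\<close> in the sample alone.\<close>

lemma finite_measurable_net:
  fixes X :: "'a::euclidean_space set"
  assumes X: "compact X" and \<eta>: "\<eta> > 0"
  obtains U and sel :: "'a \<Rightarrow> 'a" where "finite U" "U \<subseteq> X"
    "sel \<in> measurable borel (count_space UNIV)"
    "\<And>x. x \<in> X \<Longrightarrow> sel x \<in> U \<and> norm (x - sel x) < \<eta>"
proof -
  obtain U where U: "finite U" "U \<subseteq> X" "X \<subseteq> (\<Union>u\<in>U. ball u \<eta>)"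
    using compact_finite_ball_cover[OF X \<eta>] by blast
  from U(1) have "\<exists>sel::'a\<Rightarrow>'a. sel \<in> measurable borel (count_space UNIV) \<and>
      (\<forall>x\<in>(\<Union>u\<in>U. ball u \<eta>). sel x \<in> U \<and> norm (x - sel x) < \<eta>)"
  proof (induction U)
    case empty
    show ?case by (intro exI[of _ "\<lambda>_. 0"]) auto
  next
    case (insert u U)
    then obtain sel :: "'a \<Rightarrow> 'a" where sel: "sel \<in> measurable borel (count_space UNIV)"
      "\<forall>x\<in>(\<Union>u\<in>U. ball u \<eta>). sel x \<in> U \<and> norm (x - sel x) < \<eta>" by blast
    have "(\<lambda>x. if x \<in> ball u \<eta> then u else sel x) \<in> measurable borel (count_space UNIV)"
      using sel(1) by (intro measurable_If_set) auto
    then show ?case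
      using sel(2) by (intro exI[of _ "\<lambda>x. if x \<in> ball u \<eta> then u else sel x"])
        (auto simp: dist_norm norm_minus_commute)
  qed
  then show thesis using that U by blast
qed

section \<open>Square-integrable martingales and almost supermartingales\<close>

lemma integrable_mult_of_squares:
  fixes u v :: "'a \<Rightarrow> real"
  assumes [measurable]: "u \<in> borel_measurable M" "v \<in> borel_measurable M"
    and "integrable M (\<lambda>x. (u x)\<^sup>2)" "integrable M (\<lambda>x. (v x)\<^sup>2)"
  shows "integrable M (\<lambda>x. u x * v x)"
proof (rule Bochner_Integration.integrable_bound)
  show "integrable M (\<lambda>x. (u x)\<^sup>2 + (v x)\<^sup>2)"
    using assms by simp
  have "\<bar>a * b\<bar> \<le> a\<^sup>2 + b\<^sup>2" for a b :: real
  proof -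
    have "2 * (\<bar>a\<bar> * \<bar>b\<bar>) \<le> a\<^sup>2 + b\<^sup>2"
      using sum_squares_bound[of "\<bar>a\<bar>" "\<bar>b\<bar>"] by (simp add: mult.assoc)
    then show ?thesis
      using mult_nonneg_nonneg[OF abs_ge_zero[of a] abs_ge_zero[of b]]
      unfolding abs_mult by linarith
  qed
  then show "AE x in M. norm (u x * v x) \<le> norm ((u x)\<^sup>2 + (v x)\<^sup>2)"
    by (intro AE_I2) (metis abs_ge_self order_trans real_norm_def)
qed measurable

text \<open>The summands \<open>h j * d j\<close> of a martingale transform are pairwise orthogonal in \<open>L^2\<close>.\<close>

lemma (in prob_space) martingale_transform_second_moment:
  fixes d h :: "nat \<Rightarrow> 'a \<Rightarrow> real"
  assumes sub: "\<And>n. subalgebra M (F n)"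
    and mono: "\<And>m n. m \<le> n \<Longrightarrow> sets (F m) \<subseteq> sets (F n)"
    and d: "\<And>n. d n \<in> borel_measurable (F (Suc n))"
    and sq: "\<And>n. integrable M (\<lambda>\<omega>. (d n \<omega>)\<^sup>2)"
    and centred: "\<And>n. AE \<omega> in M. real_cond_exp M (F n) (d n) \<omega> = 0"
    and h: "\<And>n. h n \<in> borel_measurable (F n)" and h1: "\<And>n \<omega>. \<bar>h n \<omega>\<bar> \<le> 1"
  shows "integrable M (\<lambda>\<omega>. (\<Sum>j<n. h j \<omega> * d j \<omega>)\<^sup>2) \<and>
         (\<integral>\<omega>. (\<Sum>j<n. h j \<omega> * d j \<omega>)\<^sup>2 \<partial>M) = (\<Sum>j<n. \<integral>\<omega>. (h j \<omega> * d j \<omega>)\<^sup>2 \<partial>M)"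
proof -
  have Fmono: "subalgebra (F n) (F m)" if "m \<le> n" for m n
    using sub mono[OF that] unfolding subalgebra_def by auto
  have dM[measurable]: "d n \<in> borel_measurable M" for n
    using measurable_from_subalg[OF sub d] .
  have hM[measurable]: "h n \<in> borel_measurable M" for n
    using measurable_from_subalg[OF sub h] .
  have hd2: "integrable M (\<lambda>\<omega>. (h n \<omega> * d n \<omega>)\<^sup>2)" for n
  proof (rule Bochner_Integration.integrable_bound[OF sq[of n]])
    show "AE \<omega> in M. norm ((h n \<omega> * d n \<omega>)\<^sup>2) \<le> norm ((d n \<omega>)\<^sup>2)"
      using h1 by (auto simp: power_mult_distrib abs_square_le_1 mult_left_le_one_le)
  qed measurable
  define T where "T n \<omega> = (\<Sum>j<n. h j \<omega> * d j \<omega>)" for n \<omega>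
  have TF: "T n \<in> borel_measurable (F n)" for n
    unfolding T_def
  proof (rule borel_measurable_sum)
    fix j assume "j \<in> {..<n}"
    then show "(\<lambda>\<omega>. h j \<omega> * d j \<omega>) \<in> borel_measurable (F n)"
      by (intro borel_measurable_times measurable_from_subalg[OF Fmono h] measurable_from_subalg[OF Fmono d])
        auto
  qed
  have TM[measurable]: "T n \<in> borel_measurable M" for n
    using measurable_from_subalg[OF sub TF] .
  have "integrable M (\<lambda>\<omega>. (T n \<omega>)\<^sup>2) \<and>
      (\<integral>\<omega>. (T n \<omega>)\<^sup>2 \<partial>M) = (\<Sum>j<n. \<integral>\<omega>. (h j \<omega> * d j \<omega>)\<^sup>2 \<partial>M)" for n
  proof (induction n)
    case 0
    show ?case by (simp add: T_def)
  next
    case (Suc n)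
    interpret finite_measure_subalgebra M "F n"
      using sub by unfold_locales
    have Th: "integrable M (\<lambda>\<omega>. T n \<omega> * (h n \<omega> * d n \<omega>))"
      using Suc hd2 by (intro integrable_mult_of_squares) auto
    have ThF: "(\<lambda>\<omega>. T n \<omega> * h n \<omega>) \<in> borel_measurable (F n)"
      using TF h by measurable
    have "(\<integral>\<omega>. T n \<omega> * h n \<omega> * d n \<omega> \<partial>M)
        = (\<integral>\<omega>. T n \<omega> * h n \<omega> * real_cond_exp M (F n) (d n) \<omega> \<partial>M)"
      using Th ThF by (intro real_cond_exp_intg(2)[symmetric]) (auto simp: mult.assoc)
    also have "\<dots> = 0"
      using centred[of n] by (intro integral_eq_zero_AE) auto
    finally have orth: "(\<integral>\<omega>. T n \<omega> * (h n \<omega> * d n \<omega>) \<partial>M) = 0"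
      by (simp add: mult.assoc)
    have expand: "(T (Suc n) \<omega>)\<^sup>2
        = (T n \<omega>)\<^sup>2 + 2 * (T n \<omega> * (h n \<omega> * d n \<omega>)) + (h n \<omega> * d n \<omega>)\<^sup>2" for \<omega>
      by (simp add: T_def power2_sum algebra_simps)
    show ?case
      unfolding expand using Suc Th hd2 orth by simp
  qed
  then show ?thesis unfolding T_def by blast
qed

text \<open>Stop the partial sums when they first reach \<open>e\<close> in absolute value. The stopped sum \<open>T\<close> is a martingale
transform whose weights \<open>h j\<close> switch to zero at the stopping time; on the event in question
\<open>|T| \<ge> e\<close>, so Markov's inequality for \<open>T^2\<close> applies.\<close>

lemma (in prob_space) martingale_maximal_inequality:
  fixes d :: "nat \<Rightarrow> 'a \<Rightarrow> real"
  assumes sub: "\<And>n. subalgebra M (F n)"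
    and mono: "\<And>m n. m \<le> n \<Longrightarrow> sets (F m) \<subseteq> sets (F n)"
    and d: "\<And>n. d n \<in> borel_measurable (F (Suc n))"
    and sq: "\<And>n. integrable M (\<lambda>\<omega>. (d n \<omega>)\<^sup>2)"
    and centred: "\<And>n. AE \<omega> in M. real_cond_exp M (F n) (d n) \<omega> = 0"
    and e: "e > 0"
  shows "prob {\<omega> \<in> space M. \<exists>i\<in>{N..n}. e \<le> \<bar>\<Sum>j=N..<i. d j \<omega>\<bar>}
    \<le> (\<Sum>j=N..<n. \<integral>\<omega>. (d j \<omega>)\<^sup>2 \<partial>M) / e\<^sup>2"
proof -
  have Fmono: "subalgebra (F n) (F m)" if "m \<le> n" for m n
    using sub mono[OF that] unfolding subalgebra_def by auto
  have dM[measurable]: "d n \<in> borel_measurable M" for n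
    using measurable_from_subalg[OF sub d] .
  define h where "h j \<omega> = (if N \<le> j \<and> (\<forall>i\<in>{N..j}. \<bar>\<Sum>k=N..<i. d k \<omega>\<bar> < e) then 1 else 0 :: real)"
    for j \<omega>
  have hF: "h j \<in> borel_measurable (F j)" for j
  proof -
    have [measurable]: "d k \<in> borel_measurable (F j)" if "k < j" for k
      using that by (intro measurable_from_subalg[OF Fmono d]) auto
    have [measurable]: "(\<lambda>\<omega>. \<Sum>k=N..<i. d k \<omega>) \<in> borel_measurable (F j)" if "i \<in> {N..j}" for i
      using that by (intro borel_measurable_sum) auto
    have "(\<lambda>\<omega>. if (\<forall>i\<in>{N..j}. \<bar>\<Sum>k=N..<i. d k \<omega>\<bar> < e) then 1 else 0 :: real)
        \<in> borel_measurable (F j)"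
      by (intro measurable_If sets.sets_Collect_finite_All) (auto intro!: pred_Collect_borel)
    then show ?thesis
      unfolding h_def by (cases "N \<le> j") auto
  qed
  have h1: "\<bar>h j \<omega>\<bar> \<le> 1" for j \<omega> by (simp add: h_def)
  have hM[measurable]: "h j \<in> borel_measurable M" for j
    using measurable_from_subalg[OF sub hF] .
  define T where "T \<omega> = (\<Sum>j<n. h j \<omega> * d j \<omega>)" for \<omega>
  have T2: "integrable M (\<lambda>\<omega>. (T \<omega>)\<^sup>2)"
    and ET2: "(\<integral>\<omega>. (T \<omega>)\<^sup>2 \<partial>M) = (\<Sum>j<n. \<integral>\<omega>. (h j \<omega> * d j \<omega>)\<^sup>2 \<partial>M)"
    using martingale_transform_second_moment[where F=F and d=d and h=h, OF sub mono d sq centred hF h1, of n]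
    unfolding T_def by auto
  have stop: "e\<^sup>2 \<le> (T \<omega>)\<^sup>2" if "i \<in> {N..n}" "e \<le> \<bar>\<Sum>j=N..<i. d j \<omega>\<bar>" for i \<omega>
  proof -
    define t where "t = (LEAST i. i \<in> {N..n} \<and> e \<le> \<bar>\<Sum>j=N..<i. d j \<omega>\<bar>)"
    have t: "t \<in> {N..n}" "e \<le> \<bar>\<Sum>j=N..<t. d j \<omega>\<bar>"
      using LeastI[of "\<lambda>i. i \<in> {N..n} \<and> e \<le> \<bar>\<Sum>j=N..<i. d j \<omega>\<bar>" i] that
      unfolding t_def by auto
    have before: "\<bar>\<Sum>j=N..<i. d j \<omega>\<bar> < e" if "i < t" "N \<le> i" for i
      using not_less_Least[of i "\<lambda>i. i \<in> {N..n} \<and> e \<le> \<bar>\<Sum>j=N..<i. d j \<omega>\<bar>"] that t(1)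
      unfolding t_def[symmetric] by auto
    have "h j \<omega> = (if j \<in> {N..<t} then 1 else 0)" for j
    proof (cases "j < t")
      case True
      then have "h j \<omega> = (if N \<le> j then 1 else 0)"
        unfolding h_def using before by auto
      then show ?thesis using True by auto
    next
      case False
      then show ?thesis using t unfolding h_def by (auto simp: not_less)
    qed
    then have "T \<omega> = (\<Sum>j<n. if j \<in> {N..<t} then d j \<omega> else 0)"
      unfolding T_def by (intro sum.cong) auto
    also have "\<dots> = (\<Sum>j\<in>{..<n} \<inter> {N..<t}. d j \<omega>)"
      by (simp add: sum.inter_restrict)
    also have "{..<n} \<inter> {N..<t} = {N..<t}" using t(1) by auto
    finally show ?thesis
      using t(2) e by (metis abs_of_pos abs_le_square_iff)
  qed
  have "prob {\<omega> \<in> space M. \<exists>i\<in>{N..n}. e \<le> \<bar>\<Sum>j=N..<i. d j \<omega>\<bar>}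
      \<le> prob {\<omega> \<in> space M. e\<^sup>2 \<le> (T \<omega>)\<^sup>2}"
    using stop by (intro finite_measure_mono) (auto simp: T_def)
  also have "\<dots> \<le> (\<integral>\<omega>. (T \<omega>)\<^sup>2 \<partial>M) / e\<^sup>2"
    using T2 e by (intro integral_Markov_inequality_measure[where A="space M - space M"]) auto
  also have "(\<integral>\<omega>. (T \<omega>)\<^sup>2 \<partial>M) \<le> (\<Sum>j=N..<n. \<integral>\<omega>. (d j \<omega>)\<^sup>2 \<partial>M)"
  proof -
    have "(\<integral>\<omega>. (h j \<omega> * d j \<omega>)\<^sup>2 \<partial>M) \<le> (if j \<in> {N..<n} then \<integral>\<omega>. (d j \<omega>)\<^sup>2 \<partial>M else 0)" if "j < n" for j
    proof (cases "N \<le> j")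
      case True
      then show ?thesis using that
        by (auto intro!: integral_mono_AE' sq simp: h_def)
    next
      case False
      then show ?thesis by (simp add: h_def)
    qed
    then have "(\<integral>\<omega>. (T \<omega>)\<^sup>2 \<partial>M) \<le> (\<Sum>j<n. if j \<in> {N..<n} then \<integral>\<omega>. (d j \<omega>)\<^sup>2 \<partial>M else 0)"
      unfolding ET2 by (intro sum_mono) auto
    also have "\<dots> = (\<Sum>j\<in>{..<n} \<inter> {N..<n}. \<integral>\<omega>. (d j \<omega>)\<^sup>2 \<partial>M)"
      by (simp add: sum.inter_restrict)
    also have "{..<n} \<inter> {N..<n} = {N..<n}" by auto
    finally show ?thesis .
  qed
  finally show ?thesis using e by (simp add: divide_right_mono)
qed

text \<open>By the maximal inequality the oscillation of the partial sums beyond \<open>N\<close> exceeds a given level with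
a probability controlled by the tail of the summed variances. Almost every path is therefore Cauchy.\<close>

lemma (in prob_space) L2_martingale_convergence:
  fixes d :: "nat \<Rightarrow> 'a \<Rightarrow> real"
  assumes sub: "\<And>n. subalgebra M (F n)"
    and mono: "\<And>m n. m \<le> n \<Longrightarrow> sets (F m) \<subseteq> sets (F n)"
    and d: "\<And>n. d n \<in> borel_measurable (F (Suc n))"
    and sq: "\<And>n. integrable M (\<lambda>\<omega>. (d n \<omega>)\<^sup>2)"
    and centred: "\<And>n. AE \<omega> in M. real_cond_exp M (F n) (d n) \<omega> = 0"
    and summ: "summable (\<lambda>n. \<integral>\<omega>. (d n \<omega>)\<^sup>2 \<partial>M)"
  shows "AE \<omega> in M. summable (\<lambda>n. d n \<omega>)"
proof -
  have dM[measurable]: "d n \<in> borel_measurable M" for n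
    using measurable_from_subalg[OF sub d] .
  define v where "v j = (\<integral>\<omega>. (d j \<omega>)\<^sup>2 \<partial>M)" for j
  have v0: "v j \<ge> 0" for j unfolding v_def by simp
  define B where "B e N = {\<omega> \<in> space M. \<exists>i\<ge>N. e \<le> \<bar>\<Sum>j=N..<i. d j \<omega>\<bar>}" for e N
  have Bm[measurable]: "B e N \<in> sets M" for e N
    unfolding B_def by measurable
  have tail: "prob (B e N) \<le> (\<Sum>j. v (j + N)) / e\<^sup>2" if e: "e > 0" for e N
  proof -
    define Bn where "Bn n = {\<omega> \<in> space M. \<exists>i\<in>{N..n}. e \<le> \<bar>\<Sum>j=N..<i. d j \<omega>\<bar>}" for n
    have "(\<lambda>n. prob (Bn n)) \<longlonglongrightarrow> prob (\<Union>n. Bn n)"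
      by (intro finite_Lim_measure_incseq) (fastforce simp: Bn_def incseq_def)+
    moreover have "(\<Union>n. Bn n) = B e N"
      unfolding Bn_def B_def by (auto intro: exI[where x="_::nat"] bexI[where x="_::nat"] simp: Bex_def)
    moreover have "prob (Bn n) \<le> (\<Sum>j. v (j + N)) / e\<^sup>2" for n
    proof -
      have "prob (Bn n) \<le> (\<Sum>j=N..<n. v j) / e\<^sup>2"
        unfolding Bn_def v_def
        by (rule martingale_maximal_inequality[where F=F and d=d, OF sub mono d sq centred e])
      also have "(\<Sum>j=N..<n. v j) = (\<Sum>j<n-N. v (j + N))"
        by (rule sum.reindex_bij_witness[where i="\<lambda>j. j + N" and j="\<lambda>j. j - N"]) auto
      also have "\<dots> \<le> (\<Sum>j. v (j + N))"
        using summ v0 by (intro sum_le_suminf) (auto simp: v_def[symmetric] summable_iff_shift)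
      finally show ?thesis by (simp add: divide_right_mono)
    qed
    ultimately show ?thesis by (auto intro: LIMSEQ_le_const2)
  qed
  have "AE \<omega> in M. \<exists>N. \<omega> \<notin> B (1 / real (Suc p)) N" for p
  proof -
    have lim: "(\<lambda>N. (\<Sum>j. v (j + N)) / (1 / real (Suc p))\<^sup>2) \<longlonglongrightarrow> 0 / (1 / real (Suc p))\<^sup>2"
      using summ by (intro tendsto_divide suminf_exist_split2 tendsto_const) (auto simp: v_def)
    have bound: "prob (\<Inter>N. B (1 / real (Suc p)) N) \<le> (\<Sum>j. v (j + N)) / (1 / real (Suc p))\<^sup>2" for N
      by (rule order_trans[OF finite_measure_mono tail]) auto
    have "prob (\<Inter>N. B (1 / real (Suc p)) N) \<le> 0 / (1 / real (Suc p))\<^sup>2"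
      by (rule LIMSEQ_le_const[OF lim]) (use bound in blast)
    then have "prob (\<Inter>N. B (1 / real (Suc p)) N) = 0"
      by (simp add: measure_le_0_iff)
    then have "(\<Inter>N. B (1 / real (Suc p)) N) \<in> null_sets M"
      by (simp add: null_sets_def emeasure_eq_measure)
    from AE_not_in[OF this] show ?thesis by auto
  qed
  then have "AE \<omega> in M. \<forall>p. \<exists>N. \<omega> \<notin> B (1 / real (Suc p)) N"
    by (simp add: AE_all_countable)
  with AE_space show ?thesis
  proof eventually_elim
    case (elim \<omega>)
    show "summable (\<lambda>n. d n \<omega>)"
      unfolding summable_Cauchy
    proof (intro allI impI)
      fix e :: real assume "e > 0"
      then obtain p where p: "1 / real (Suc p) < e / 2"
        using nat_approx_posE[of "e / 2"] by auto
      from elim(2) obtain N where "\<omega> \<notin> B (1 / real (Suc p)) N" by blast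
      with elim(1) have "\<not> 1 / real (Suc p) \<le> \<bar>\<Sum>j=N..<i. d j \<omega>\<bar>" if "i \<ge> N" for i
        using that unfolding B_def by blast
      then have N: "\<bar>\<Sum>j=N..<i. d j \<omega>\<bar> < 1 / real (Suc p)" if "i \<ge> N" for i
        using that by (simp only: not_le)
      show "\<exists>N. \<forall>m\<ge>N. \<forall>n. norm (sum (\<lambda>n. d n \<omega>) {m..<n}) < e"
      proof (intro exI[of _ N] allI impI)
        fix m n assume "N \<le> m"
        show "norm (sum (\<lambda>n. d n \<omega>) {m..<n}) < e"
        proof (cases "m \<le> n")
          case True
          then have "(\<Sum>j=m..<n. d j \<omega>) = (\<Sum>j=N..<n. d j \<omega>) - (\<Sum>j=N..<m. d j \<omega>)"
            using \<open>N \<le> m\<close> by (subst sum.atLeastLessThan_concat[of N m n, symmetric]) auto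
          then show ?thesis using N[of n] N[of m] True \<open>N \<le> m\<close> p by simp
        qed (use \<open>e > 0\<close> in auto)
      qed
    qed
  qed
qed

text \<open>The Doob decomposition splits the increments of \<open>Y\<close> into martingale differences \<open>d\<close>, whose sum
converges because their variances are at most \<open>c\<close>, and predictable drifts \<open>h\<close>. Along a path, \<open>Y\<close> is
bounded, \<open>\<Sum>d\<close> and \<open>\<Sum>a\<close> converge, and \<open>a - h\<close> dominates \<open>w\<close>; so the partial sums of \<open>a - h\<close> are
bounded and monotone, and both conclusions follow.\<close>

lemma (in prob_space) robbins_siegmund_bounded:
  fixes Y w a c :: "nat \<Rightarrow> _"
  assumes sub: "\<And>n. subalgebra M (F n)"
    and mono: "\<And>m n. m \<le> n \<Longrightarrow> sets (F m) \<subseteq> sets (F n)"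
    and Y: "\<And>n. Y n \<in> borel_measurable (F n)"
    and bounded: "\<And>n \<omega>. \<omega> \<in> space M \<Longrightarrow> \<bar>Y n \<omega>\<bar> \<le> (B::real)"
    and incr: "\<And>n. (\<integral>\<omega>. (Y (Suc n) \<omega> - Y n \<omega>)\<^sup>2 \<partial>M) \<le> c n" and c: "summable c"
    and drift: "\<And>n. AE \<omega> in M. real_cond_exp M (F n) (Y (Suc n)) \<omega> \<le> Y n \<omega> - w n \<omega> + a n"
    and w: "\<And>n \<omega>. \<omega> \<in> space M \<Longrightarrow> w n \<omega> \<ge> (0::real)" and a: "summable a"
  shows "AE \<omega> in M. convergent (\<lambda>n. Y n \<omega>) \<and> summable (\<lambda>n. w n \<omega>)"
proof -
  have Fmono: "subalgebra (F n) (F m)" if "m \<le> n" for m n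
    using sub mono[OF that] unfolding subalgebra_def by auto
  have YM[measurable]: "Y n \<in> borel_measurable M" for n
    using measurable_from_subalg[OF sub Y] .
  have bdd: "integrable M f" if "f \<in> borel_measurable M" "\<And>\<omega>. \<omega> \<in> space M \<Longrightarrow> \<bar>f \<omega>\<bar> \<le> K" for f :: "'a \<Rightarrow> real" and K
    using that by (intro integrable_const_bound[where B=K]) auto
  have Yint: "integrable M (Y n)" for n
    by (rule bdd[OF YM bounded])
  define Z where "Z n \<omega> = Y (Suc n) \<omega> - Y n \<omega>" for n \<omega>
  have ZM[measurable]: "Z n \<in> borel_measurable M" for n unfolding Z_def by measurable
  have Zb: "\<bar>Z n \<omega>\<bar> \<le> 2 * B" if "\<omega> \<in> space M" for n \<omega>
    unfolding Z_def using bounded[OF that, of n] bounded[OF that, of "Suc n"] by auto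
  have Zint: "integrable M (Z n)" for n
    by (rule bdd[OF ZM Zb])
  define h where "h n = real_cond_exp M (F n) (Z n)" for n
  define d where "d n \<omega> = Z n \<omega> - h n \<omega>" for n \<omega>
  have hF: "h n \<in> borel_measurable (F n)" for n unfolding h_def by simp
  have hM[measurable]: "h n \<in> borel_measurable M" for n unfolding h_def by simp
  have hle: "AE \<omega> in M. h n \<omega> \<le> - w n \<omega> + a n" for n
  proof -
    interpret finite_measure_subalgebra M "F n"
      using sub by unfold_locales
    have "AE \<omega> in M. h n \<omega> = real_cond_exp M (F n) (Y (Suc n)) \<omega> - real_cond_exp M (F n) (Y n) \<omega>"
      unfolding h_def Z_def by (rule real_cond_exp_diff[OF Yint Yint])
    with real_cond_exp_F_meas[OF Yint[of n] Y[of n]] drift[of n] show ?thesis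
      by eventually_elim auto
  qed
  have d: "d n \<in> borel_measurable (F (Suc n)) \<and> integrable M (\<lambda>\<omega>. (d n \<omega>)\<^sup>2)
      \<and> (\<integral>\<omega>. (d n \<omega>)\<^sup>2 \<partial>M) \<le> c n \<and> (AE \<omega> in M. real_cond_exp M (F n) (d n) \<omega> = 0)" for n
  proof -
    interpret finite_measure_subalgebra M "F n"
      using sub by unfold_locales
    have "Y (Suc n) \<in> borel_measurable (F (Suc n))" by (rule Y)
    moreover have "Y n \<in> borel_measurable (F (Suc n))" "h n \<in> borel_measurable (F (Suc n))"
      by (rule measurable_from_subalg[OF Fmono Y] measurable_from_subalg[OF Fmono hF], simp)+
    ultimately have dF: "d n \<in> borel_measurable (F (Suc n))"
      unfolding d_def Z_def by measurable
    have hb: "AE \<omega> in M. \<bar>h n \<omega>\<bar> \<le> 2 * B"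
    proof -
      have "AE \<omega> in M. h n \<omega> \<ge> - (2 * B)"
        unfolding h_def using Zb by (intro real_cond_exp_ge_c[OF Zint] AE_I2) (auto simp: abs_le_iff minus_le_iff)
      moreover have "AE \<omega> in M. h n \<omega> \<le> 2 * B"
        unfolding h_def using Zb by (intro real_cond_exp_le_c[OF Zint] AE_I2) (auto simp: abs_le_iff)
      ultimately show ?thesis by eventually_elim auto
    qed
    have Z2: "integrable M (\<lambda>\<omega>. (Z n \<omega>)\<^sup>2)"
      using power_mono[OF Zb abs_ge_zero, of _ n 2] by (intro bdd[of _ "(2 * B)\<^sup>2"]) auto
    have h2: "integrable M (\<lambda>\<omega>. (h n \<omega>)\<^sup>2)"
    proof (rule integrable_const_bound[where B="(2 * B)\<^sup>2"])
      show "AE \<omega> in M. norm ((h n \<omega>)\<^sup>2) \<le> (2 * B)\<^sup>2"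
        using hb by eventually_elim (use power_mono[of "\<bar>_\<bar>" "2 * B" 2] in auto)
    qed measurable
    have hZ: "integrable M (\<lambda>\<omega>. h n \<omega> * Z n \<omega>)"
      by (intro integrable_mult_of_squares Z2 h2 ZM hM)
    have expand: "(d n \<omega>)\<^sup>2 = (Z n \<omega>)\<^sup>2 - 2 * (h n \<omega> * Z n \<omega>) + (h n \<omega>)\<^sup>2" for \<omega>
      by (simp add: d_def power2_diff algebra_simps)
    have sqd: "integrable M (\<lambda>\<omega>. (d n \<omega>)\<^sup>2)"
      unfolding expand using Z2 hZ h2 by simp
    have "(\<integral>\<omega>. h n \<omega> * Z n \<omega> \<partial>M) = (\<integral>\<omega>. h n \<omega> * h n \<omega> \<partial>M)"
      unfolding h_def using hZ[unfolded h_def] by (intro real_cond_exp_intg(2)[symmetric]) auto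
    then have "(\<integral>\<omega>. (d n \<omega>)\<^sup>2 \<partial>M) = (\<integral>\<omega>. (Z n \<omega>)\<^sup>2 \<partial>M) - (\<integral>\<omega>. (h n \<omega>)\<^sup>2 \<partial>M)"
      unfolding expand using Z2 hZ h2 by (simp add: power2_eq_square)
    also have "\<dots> \<le> c n" using incr[of n] unfolding Z_def by (smt (verit) integral_nonneg_AE AE_I2 zero_le_power2)
    finally have var: "(\<integral>\<omega>. (d n \<omega>)\<^sup>2 \<partial>M) \<le> c n" .
    have cen: "AE \<omega> in M. real_cond_exp M (F n) (d n) \<omega> = 0"
    proof -
      have hint: "integrable M (h n)" unfolding h_def by (rule real_cond_exp_int(1)[OF Zint])
      have "AE \<omega> in M. real_cond_exp M (F n) (d n) \<omega> = real_cond_exp M (F n) (Z n) \<omega> - real_cond_exp M (F n) (h n) \<omega>"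
        unfolding d_def by (rule real_cond_exp_diff[OF Zint hint])
      with real_cond_exp_F_meas[OF hint hF] show ?thesis
        by eventually_elim (simp add: h_def)
    qed
    from dF sqd var cen show ?thesis by blast
  qed
  have "summable (\<lambda>n. \<integral>\<omega>. (d n \<omega>)\<^sup>2 \<partial>M)"
    using d by (intro summable_comparison_test'[OF c, where N=0]) auto
  with d have "AE \<omega> in M. summable (\<lambda>n. d n \<omega>)"
    by (intro L2_martingale_convergence[where F=F, OF sub mono]) auto
  moreover have "AE \<omega> in M. \<forall>n. h n \<omega> \<le> - w n \<omega> + a n"
    using hle by (simp add: AE_all_countable)
  ultimately show ?thesis
    using AE_space
  proof eventually_elim
    case (elim \<omega>)
    define q where "q n = a n - h n \<omega>" for n
    have qw: "w n \<omega> \<le> q n" for n using spec[OF elim(2), of n] unfolding q_def by linarith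
    have q0: "0 \<le> q n" for n using qw[of n] w[OF elim(3), of n] by linarith
    have Yn: "Y n \<omega> = Y 0 \<omega> + (\<Sum>j<n. d j \<omega>) + (\<Sum>j<n. a j) - (\<Sum>j<n. q j)" for n
      by (induction n) (auto simp: q_def d_def Z_def)
    have cd: "convergent (\<lambda>n. \<Sum>j<n. d j \<omega>)" and ca: "convergent (\<lambda>n. \<Sum>j<n. a j)"
      using elim(1) a by (simp_all add: summable_iff_convergent)
    then have "Bseq (\<lambda>n. \<Sum>j<n. d j \<omega>)" "Bseq (\<lambda>n. \<Sum>j<n. a j)"
      by (auto intro: convergent_imp_Bseq)
    then obtain K1 K2 where K: "\<And>n. \<bar>\<Sum>j<n. d j \<omega>\<bar> \<le> K1" "\<And>n. \<bar>\<Sum>j<n. a j\<bar> \<le> K2"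
      unfolding Bseq_def real_norm_def by metis
    have "summable q"
    proof (rule summableI_nonneg_bounded[OF q0])
      fix n
      show "(\<Sum>j<n. q j) \<le> K1 + K2 + 2 * B"
        using Yn[of n] K[of n] bounded[OF elim(3), of n] bounded[OF elim(3), of 0] by (auto simp: abs_le_iff)
    qed
    then have "summable (\<lambda>n. w n \<omega>)"
      using qw w[OF elim(3)] by (intro summable_comparison_test'[OF \<open>summable q\<close>]) auto
    moreover have "convergent (\<lambda>n. Y n \<omega>)"
    proof (subst ext[of "\<lambda>n. Y n \<omega>", OF Yn])
      show "convergent (\<lambda>n. Y 0 \<omega> + (\<Sum>j<n. d j \<omega>) + (\<Sum>j<n. a j) - (\<Sum>j<n. q j))"
        using cd ca \<open>summable q\<close>
        by (intro convergent_add convergent_diff convergent_const) (auto simp: summable_iff_convergent)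
    qed
    ultimately show ?case by blast
  qed
qed

section \<open>Independent samples and their past\<close>

lemma past_measurable_history:
  assumes "\<And>k. S k \<in> measurable M P"
  shows "(\<lambda>\<omega>. \<lambda>i\<in>{..<k}. S i \<omega>) \<in> measurable M (PiM {..<k} (\<lambda>_. P))"
  using assms by (intro measurable_restrict) auto

lemma subalgebra_past:
  assumes "\<And>k. S k \<in> measurable M P"
  shows "subalgebra M (past M P S k)"
  unfolding subalgebra_def past_def
  using sets_image_in_sets[OF refl past_measurable_history[OF assms]] by simp

lemma measurable_past_sample:
  assumes S: "\<And>k. S k \<in> measurable M P" and "i < k"
  shows "S i \<in> measurable (past M P S k) P"
proof -
  have "(\<lambda>\<omega>. \<lambda>i\<in>{..<k}. S i \<omega>) \<in> measurable (past M P S k) (PiM {..<k} (\<lambda>_. P))"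
    unfolding past_def using measurable_space[OF past_measurable_history[OF S]]
    by (intro measurable_vimage_algebra1) auto
  from measurable_compose[OF this measurable_component_singleton[of i]] assms(2)
  show ?thesis by simp
qed

lemma past_mono:
  assumes S: "\<And>k. S k \<in> measurable M P" and "m \<le> n"
  shows "sets (past M P S m) \<subseteq> sets (past M P S n)"
proof -
  have "(\<lambda>\<omega>. \<lambda>i\<in>{..<m}. S i \<omega>) \<in> measurable (past M P S n) (PiM {..<m} (\<lambda>_. P))"
    using assms(2) by (intro measurable_restrict measurable_past_sample[OF S]) auto
  then show ?thesis
    unfolding past_def[of M P S m] by (intro sets_image_in_sets) (auto simp: past_def)
qed

lemma iid_samples_measurable:
  assumes "prob_space M" "iid_samples M P S"
  shows "S k \<in> measurable M P"
  using assms unfolding iid_samples_def by (auto simp: prob_space.indep_vars_def)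

lemma iid_samples_AE:
  assumes "prob_space M" "iid_samples M P S" "AE s in P. Q s"
  shows "AE \<omega> in M. \<forall>k. Q (S k \<omega>)"
proof -
  have "AE \<omega> in M. Q (S k \<omega>)" for k
  proof -
    have "AE s in distr M P (S k). Q s"
      using assms(2,3) unfolding iid_samples_def by metis
    then show ?thesis by (rule AE_distrD[OF iid_samples_measurable[OF assms(1,2)]])
  qed
  then show ?thesis by (simp add: AE_all_countable)
qed

lemma iid_samples_integral:
  fixes \<psi> :: "'s \<Rightarrow> real"
  assumes "prob_space M" "iid_samples M P S" "integrable P \<psi>"
  shows "integrable M (\<lambda>\<omega>. \<psi> (S k \<omega>))" "(\<integral>\<omega>. \<psi> (S k \<omega>) \<partial>M) = (\<integral>s. \<psi> s \<partial>P)"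
proof -
  have d: "distr M P (S k) = P" using assms(2) unfolding iid_samples_def by simp
  note [measurable] = iid_samples_measurable[OF assms(1,2)]
  show "integrable M (\<lambda>\<omega>. \<psi> (S k \<omega>))"
    using assms(3) integrable_distr[of "S k" M P \<psi>] d by simp
  show "(\<integral>\<omega>. \<psi> (S k \<omega>) \<partial>M) = (\<integral>s. \<psi> s \<partial>P)"
    using integral_distr[of "S k" M P \<psi>] d assms(3) by simp
qed

text \<open>\<open>S k\<close> is independent of \<open>past M P S k\<close>, so conditioning on the past does nothing beyond averaging.\<close>

lemma real_cond_exp_fresh_sample:
  fixes \<psi> :: "'s \<Rightarrow> real"
  assumes M: "prob_space M" and iid: "iid_samples M P S" and \<psi>: "integrable P \<psi>"
  shows "AE \<omega> in M. real_cond_exp M (past M P S k) (\<lambda>\<omega>. \<psi> (S k \<omega>)) \<omega> = (\<integral>s. \<psi> s \<partial>P)"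
proof -
  interpret M: prob_space M by (rule M)
  note S = iid_samples_measurable[OF M iid]
  interpret finite_measure_subalgebra M "past M P S k"
    using subalgebra_past[OF S] by unfold_locales
  show ?thesis
  proof (rule real_cond_exp_charact)
    fix A assume "A \<in> sets (past M P S k)"
    then obtain C where C: "C \<in> sets (PiM {..<k} (\<lambda>_. P))"
      and A: "A = (\<lambda>\<omega>. \<lambda>i\<in>{..<k}. S i \<omega>) -` C \<inter> space M"
      unfolding past_def using measurable_space[OF past_measurable_history[OF S]]
      by (subst (asm) sets_vimage_algebra2) auto
    have "M.indep_var (PiM {..<k} (\<lambda>_. P)) (\<lambda>\<omega>. \<lambda>i\<in>{..<k}. S i \<omega>) (PiM {k} (\<lambda>_. P)) (\<lambda>\<omega>. \<lambda>i\<in>{k}. S i \<omega>)"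
      using iid unfolding iid_samples_def by (intro M.indep_var_restrict[where I=UNIV]) auto
    then have "M.indep_var borel (indicator C \<circ> (\<lambda>\<omega>. \<lambda>i\<in>{..<k}. S i \<omega>)) borel ((\<lambda>x. \<psi> (x k)) \<circ> (\<lambda>\<omega>. \<lambda>i\<in>{k}. S i \<omega>))"
      using C \<psi> by (intro M.indep_var_compose) auto
    then have ind: "M.indep_var borel (\<lambda>\<omega>. indicator C (\<lambda>i\<in>{..<k}. S i \<omega>) :: real) borel (\<lambda>\<omega>. \<psi> (S k \<omega>))"
      by (simp add: comp_def)
    have CM: "(\<lambda>\<omega>. indicator C (\<lambda>i\<in>{..<k}. S i \<omega>) :: real) \<in> borel_measurable M"
      using measurable_compose[OF past_measurable_history[OF S] borel_measurable_indicator[OF C]] .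
    have Cint: "integrable M (\<lambda>\<omega>. indicator C (\<lambda>i\<in>{..<k}. S i \<omega>) :: real)"
      using CM by (intro M.integrable_const_bound[where B=1]) (auto simp: indicator_def)
    have ind_A: "indicator A \<omega> = (indicator C (\<lambda>i\<in>{..<k}. S i \<omega>) :: real)" if "\<omega> \<in> space M" for \<omega>
      using that by (auto simp: A indicator_def)
    have "(\<integral>\<omega>\<in>A. \<psi> (S k \<omega>) \<partial>M) = (\<integral>\<omega>. indicator C (\<lambda>i\<in>{..<k}. S i \<omega>) * \<psi> (S k \<omega>) \<partial>M)"
      unfolding set_lebesgue_integral_def by (intro Bochner_Integration.integral_cong) (auto simp: ind_A)
    also have "\<dots> = (\<integral>\<omega>. indicator C (\<lambda>i\<in>{..<k}. S i \<omega>) \<partial>M) * (\<integral>s. \<psi> s \<partial>P)"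
      using M.indep_var_lebesgue_integral[OF ind Cint iid_samples_integral(1)[OF M iid \<psi>]]
        iid_samples_integral(2)[OF M iid \<psi>] by simp
    also have "\<dots> = (\<integral>\<omega>\<in>A. (\<integral>s. \<psi> s \<partial>P) \<partial>M)"
    proof -
      have "(\<integral>\<omega>. indicator C (\<lambda>i\<in>{..<k}. S i \<omega>) \<partial>M) = (\<integral>\<omega>. indicator A \<omega> \<partial>M :: real)"
        by (intro Bochner_Integration.integral_cong) (auto simp: ind_A)
      then show ?thesis unfolding set_lebesgue_integral_def by simp
    qed
    finally show "(\<integral>\<omega>\<in>A. \<psi> (S k \<omega>) \<partial>M) = (\<integral>\<omega>\<in>A. (\<integral>s. \<psi> s \<partial>P) \<partial>M)" .
  qed (auto intro: iid_samples_integral[OF M iid \<psi>])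
qed

text \<open>A fresh sample enters through one of finitely many functions \<open>\<psi> u\<close>, and the past decides which one.
On each event \<open>sel = u\<close>, which the past knows, the sample can be averaged out.\<close>

lemma real_cond_exp_le_selected:
  fixes \<psi> :: "'i \<Rightarrow> 's \<Rightarrow> real" and a :: "'w \<Rightarrow> real"
  assumes M: "prob_space M" and iid: "iid_samples M P S"
    and U: "finite U" and sel: "\<And>\<omega>. \<omega> \<in> space M \<Longrightarrow> sel \<omega> \<in> U"
      "sel \<in> measurable (past M P S k) (count_space UNIV)"
    and \<psi>: "\<And>u. u \<in> U \<Longrightarrow> integrable P (\<psi> u)"
    and a: "integrable M a" "a \<in> borel_measurable (past M P S k)" and Y: "integrable M Y"
    and le: "AE \<omega> in M. Y \<omega> \<le> a \<omega> + \<psi> (sel \<omega>) (S k \<omega>)"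
  shows "AE \<omega> in M. real_cond_exp M (past M P S k) Y \<omega> \<le> a \<omega> + (\<integral>s. \<psi> (sel \<omega>) s \<partial>P)"
proof -
  interpret M: prob_space M by (rule M)
  note S = iid_samples_measurable[OF M iid]
  interpret finite_measure_subalgebra M "past M P S k"
    using subalgebra_past[OF S] by unfold_locales
  define \<psi>' where "\<psi>' u = (if u \<in> U then \<psi> u else (\<lambda>_. 0))" for u
  have \<psi>': "integrable P (\<psi>' u)" for u using \<psi> by (auto simp: \<psi>'_def)
  define T where "T u \<omega> = indicator (sel -` {u} \<inter> space M) \<omega> * \<psi>' u (S k \<omega>)" for u \<omega>
  have selF: "sel -` {u} \<inter> space M \<in> sets (past M P S k)" for u
    using measurable_sets[OF sel(2), of "{u}"] by (simp add: past_def)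
  then have selM: "sel -` {u} \<inter> space M \<in> sets M" for u
    using subalg unfolding subalgebra_def by auto
  have iS: "integrable M (\<lambda>\<omega>. \<psi>' u (S k \<omega>))" for u by (rule iid_samples_integral(1)[OF M iid \<psi>'])
  have iT: "integrable M (T u)" for u
    unfolding T_def using integrable_mult_indicator[OF selM iS] by simp
  have Tsum: "(\<Sum>u\<in>U. T u \<omega>) = \<psi> (sel \<omega>) (S k \<omega>)" if "\<omega> \<in> space M" for \<omega>
  proof -
    have "(\<Sum>u\<in>U. T u \<omega>) = (\<Sum>u\<in>U. if u = sel \<omega> then \<psi> u (S k \<omega>) else 0)"
      using that by (intro sum.cong) (auto simp: T_def \<psi>'_def indicator_def)
    then show ?thesis using U sel(1)[OF that] by simp
  qed
  have RT: "AE \<omega> in M. real_cond_exp M (past M P S k) (T u) \<omega>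
      = indicator (sel -` {u} \<inter> space M) \<omega> * (\<integral>s. \<psi>' u s \<partial>P)" for u
  proof -
    have "AE \<omega> in M. real_cond_exp M (past M P S k) (T u) \<omega>
      = indicator (sel -` {u} \<inter> space M) \<omega> * real_cond_exp M (past M P S k) (\<lambda>\<omega>. \<psi>' u (S k \<omega>)) \<omega>"
      unfolding T_def using iT[of u, unfolded T_def] iS[of u] selF[of u]
      by (intro real_cond_exp_mult) auto
    with real_cond_exp_fresh_sample[OF M iid \<psi>'[of u], of k] show ?thesis
      by eventually_elim simp
  qed
  have RT': "AE \<omega> in M. \<forall>u\<in>U. real_cond_exp M (past M P S k) (T u) \<omega>
      = indicator (sel -` {u} \<inter> space M) \<omega> * (\<integral>s. \<psi>' u s \<partial>P)"
    using RT U by (simp add: AE_ball_countable countable_finite)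
  have iSum: "integrable M (\<lambda>\<omega>. \<Sum>u\<in>U. T u \<omega>)" using iT by auto
  have mono: "AE \<omega> in M. real_cond_exp M (past M P S k) Y \<omega>
      \<le> real_cond_exp M (past M P S k) (\<lambda>\<omega>. a \<omega> + (\<Sum>u\<in>U. T u \<omega>)) \<omega>"
  proof (rule real_cond_exp_mono)
    show "AE \<omega> in M. Y \<omega> \<le> a \<omega> + (\<Sum>u\<in>U. T u \<omega>)"
      using le AE_space by eventually_elim (simp add: Tsum)
  qed (use Y a iSum in auto)
  have add: "AE \<omega> in M. real_cond_exp M (past M P S k) (\<lambda>\<omega>. a \<omega> + (\<Sum>u\<in>U. T u \<omega>)) \<omega>
      = real_cond_exp M (past M P S k) a \<omega> + real_cond_exp M (past M P S k) (\<lambda>\<omega>. \<Sum>u\<in>U. T u \<omega>) \<omega>"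
    by (rule real_cond_exp_add[OF a(1) iSum])
  have sum: "AE \<omega> in M. real_cond_exp M (past M P S k) (\<lambda>\<omega>. \<Sum>u\<in>U. T u \<omega>) \<omega>
      = (\<Sum>u\<in>U. real_cond_exp M (past M P S k) (T u) \<omega>)"
    by (rule real_cond_exp_sum[OF iT])
  from mono add sum real_cond_exp_F_meas[OF a] RT' AE_space show ?thesis
  proof eventually_elim
    case (elim \<omega>)
    have "(\<Sum>u\<in>U. real_cond_exp M (past M P S k) (T u) \<omega>)
        = (\<Sum>u\<in>U. if u = sel \<omega> then \<integral>s. \<psi> u s \<partial>P else 0)"
      using elim by (intro sum.cong) (auto simp: \<psi>'_def indicator_def)
    also have "\<dots> = (\<integral>s. \<psi> (sel \<omega>) s \<partial>P)"
      using U sel(1)[of \<omega>] elim by simp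
    finally show ?case using elim by simp
  qed
qed

lemma summable_centred_noise:
  fixes g :: "'s \<Rightarrow> real" and \<alpha> :: "nat \<Rightarrow> real"
  assumes M: "prob_space M" and P: "prob_space P" and iid: "iid_samples M P S"
    and g: "g \<in> borel_measurable P" "integrable P (\<lambda>s. (g s)\<^sup>2)" and \<alpha>: "summable (\<lambda>k. (\<alpha> k)\<^sup>2)"
  shows "AE \<omega> in M. summable (\<lambda>k. \<alpha> k * (g (S k \<omega>) - (\<integral>s. g s \<partial>P)))"
proof -
  interpret M: prob_space M by (rule M)
  interpret P: prob_space P by (rule P)
  note S = iid_samples_measurable[OF M iid]
  have gint: "integrable P g" by (rule P.square_integrable_imp_integrable[OF g])
  define c where "c = (\<integral>s. g s \<partial>P)"
  have sq: "integrable P (\<lambda>s. (g s - c)\<^sup>2)"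
    using g gint by (simp add: power2_diff)
  show ?thesis
    unfolding c_def[symmetric]
  proof (rule M.L2_martingale_convergence[where F="past M P S"])
    fix k
    show "(\<lambda>\<omega>. \<alpha> k * (g (S k \<omega>) - c)) \<in> borel_measurable (past M P S (Suc k))"
      using measurable_compose[OF measurable_past_sample[OF S, of k "Suc k"] g(1)] by auto
    show "integrable M (\<lambda>\<omega>. (\<alpha> k * (g (S k \<omega>) - c))\<^sup>2)"
      using iid_samples_integral(1)[OF M iid sq] by (simp add: power_mult_distrib)
    have "AE \<omega> in M. real_cond_exp M (past M P S k) (\<lambda>\<omega>. \<alpha> k * (g (S k \<omega>) - c)) \<omega>
        = (\<integral>s. \<alpha> k * (g s - c) \<partial>P)"
      using gint by (intro real_cond_exp_fresh_sample[OF M iid]) auto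
    also have "(\<integral>s. \<alpha> k * (g s - c) \<partial>P) = 0"
      using gint by (simp add: c_def P.prob_space)
    finally show "AE \<omega> in M. real_cond_exp M (past M P S k) (\<lambda>\<omega>. \<alpha> k * (g (S k \<omega>) - c)) \<omega> = 0" .
  next
    have "(\<integral>\<omega>. (\<alpha> k * (g (S k \<omega>) - c))\<^sup>2 \<partial>M) = (\<alpha> k)\<^sup>2 * (\<integral>s. (g s - c)\<^sup>2 \<partial>P)" for k
      using iid_samples_integral(2)[OF M iid sq] by (simp add: power_mult_distrib)
    then show "summable (\<lambda>k. \<integral>\<omega>. (\<alpha> k * (g (S k \<omega>) - c))\<^sup>2 \<partial>M)"
      using \<alpha> by (simp add: summable_mult2)
  qed (intro subalgebra_past[OF S] past_mono[OF S])+
qed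

section \<open>Paths with a summable potential\<close>

text \<open>Suppose \<open>D (y m) \<ge> 2 e\<close> for a late index \<open>m\<close>. As \<open>\<Sum>\<alpha>\<close> diverges while \<open>\<Sum>\<alpha> D\<close> converges, there is a first
later index \<open>n\<close> with \<open>D (y n) < e\<close>, and \<open>D \<ge> e\<close> in between makes \<open>\<Sum>\<alpha>\<close> over \<open>[m, n)\<close> tiny. The
points \<open>y m\<close> and \<open>y n\<close> are then too close for \<open>D\<close> to drop by \<open>e\<close>.\<close>

lemma potential_tendsto_zero:
  fixes y :: "nat \<Rightarrow> 'a::euclidean_space" and D :: "'a \<Rightarrow> real" and \<alpha> g :: "nat \<Rightarrow> real"
  assumes X: "compact X" and D: "continuous_on X D" and D0: "\<And>x. x \<in> X \<Longrightarrow> D x \<ge> 0"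
    and y: "\<And>k. y k \<in> X" and \<alpha>: "\<And>k. \<alpha> k > 0" "\<not> summable \<alpha>"
    and sD: "summable (\<lambda>k. \<alpha> k * D (y k))"
    and step: "\<And>k. norm (y (Suc k) - y k) \<le> \<alpha> k * g k"
    and noise: "summable (\<lambda>k. \<alpha> k * (g k - c))" and c: "c \<ge> 0"
  shows "(\<lambda>k. D (y k)) \<longlonglongrightarrow> 0"
proof -
  have travel: "norm (y n - y m) \<le> (\<Sum>k=m..<n. \<alpha> k * g k)" if "m \<le> n" for m n
    using that
  proof (induction n rule: dec_induct)
    case (step n)
    have "norm (y (Suc n) - y m) \<le> norm (y (Suc n) - y n) + norm (y n - y m)"
      using norm_triangle_ineq[of "y (Suc n) - y n" "y n - y m"] by simp
    with step assms(8)[of n] show ?case by simp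
  qed simp
  have small: "\<forall>\<^sub>F k in sequentially. D (y k) < 2 * e" if e: "e > 0" for e
  proof -
    from compact_uniformly_continuous[OF D X] e
    have "\<exists>d>0. \<forall>x\<in>X. \<forall>x'\<in>X. dist x' x < d \<longrightarrow> dist (D x') (D x) < e"
      unfolding uniformly_continuous_on_def by simp
    then obtain d where d: "d > 0" "\<And>x x'. x \<in> X \<Longrightarrow> x' \<in> X \<Longrightarrow> dist x' x < d \<Longrightarrow> dist (D x') (D x) < e"
      by auto
    \<comment> \<open>Chosen so that \<open>\<Sum>\<alpha> D < b\<close> over a stretch with \<open>D \<ge> e\<close> makes the drift \<open>c \<Sum>\<alpha>\<close> less than \<open>d / 2\<close>.\<close>
    define b where "b = e * d / (2 * (c + 1))"
    have b: "b > 0" using e d c by (simp add: b_def)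
    have "\<exists>N. \<forall>m\<ge>N. \<forall>n. norm (\<Sum>k=m..<n. \<alpha> k * (g k - c)) < d / 2"
      using noise d(1) unfolding summable_Cauchy by (meson half_gt_zero)
    then obtain N1 where N1: "\<And>m n. N1 \<le> m \<Longrightarrow> \<bar>\<Sum>k=m..<n. \<alpha> k * (g k - c)\<bar> < d / 2"
      by auto
    have "\<exists>N. \<forall>m\<ge>N. \<forall>n. norm (\<Sum>k=m..<n. \<alpha> k * D (y k)) < b"
      using sD b unfolding summable_Cauchy by simp
    then obtain N2 where N2: "\<And>m n. N2 \<le> m \<Longrightarrow> \<bar>\<Sum>k=m..<n. \<alpha> k * D (y k)\<bar> < b"
      by auto
    have "D (y m) < 2 * e" if m: "m \<ge> max N1 N2" for m
    proof (rule ccontr)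
      assume big: "\<not> D (y m) < 2 * e"
      have "\<exists>n\<ge>m. D (y n) < e"
      proof (rule ccontr)
        assume "\<not> ?thesis"
        then have ge: "e \<le> D (y n)" if "n \<ge> m" for n using that by (auto simp: not_less)
        have "summable \<alpha>"
        proof (rule summable_comparison_test')
          show "summable (\<lambda>k. (1 / e) * (\<alpha> k * D (y k)))" by (intro summable_mult sD)
          show "norm (\<alpha> n) \<le> (1 / e) * (\<alpha> n * D (y n))" if "m \<le> n" for n
            using mult_left_mono[OF ge[OF that], of "\<alpha> n"] \<alpha>(1)[of n] e by (simp add: field_simps)
        qed
        with \<alpha>(2) show False by simp
      qed
      then obtain n0 where n0: "n0 \<ge> m \<and> D (y n0) < e" by blast
      define n where "n = (LEAST n. n \<ge> m \<and> D (y n) < e)"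
      have n: "n \<ge> m" "D (y n) < e"
        using LeastI[of "\<lambda>n. n \<ge> m \<and> D (y n) < e", OF n0] unfolding n_def by auto
      have before: "e \<le> D (y k)" if "m \<le> k" "k < n" for k
        using not_less_Least[of k "\<lambda>n. n \<ge> m \<and> D (y n) < e"] that unfolding n_def[symmetric] by auto
      have "e * (\<Sum>k=m..<n. \<alpha> k) \<le> (\<Sum>k=m..<n. \<alpha> k * D (y k))"
        unfolding sum_distrib_left
      proof (rule sum_mono)
        fix k assume "k \<in> {m..<n}"
        then show "e * \<alpha> k \<le> \<alpha> k * D (y k)"
          using mult_left_mono[OF before[of k], of "\<alpha> k"] \<alpha>(1)[of k] by (simp add: mult.commute)
      qed
      also have "\<dots> < b" using N2[of m n] m by simp
      finally have eA: "e * (\<Sum>k=m..<n. \<alpha> k) < b" .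
      have A: "(\<Sum>k=m..<n. \<alpha> k) < d / (2 * (c + 1))"
      proof -
        have "e * (\<Sum>k=m..<n. \<alpha> k) < e * (d / (2 * (c + 1)))" using eA by (simp add: b_def)
        then show ?thesis using e by (simp only: mult_less_cancel_left_pos)
      qed
      have A0: "0 \<le> (\<Sum>k=m..<n. \<alpha> k)" using \<alpha>(1) by (intro sum_nonneg) (simp add: less_imp_le)
      have "norm (y n - y m) \<le> (\<Sum>k=m..<n. \<alpha> k * g k)" by (rule travel[OF n(1)])
      also have "\<dots> = c * (\<Sum>k=m..<n. \<alpha> k) + (\<Sum>k=m..<n. \<alpha> k * (g k - c))"
        by (simp add: sum_distrib_left algebra_simps flip: sum.distrib)
      also have "\<dots> < d"
      proof -
        have "c * (\<Sum>k=m..<n. \<alpha> k) \<le> (c + 1) * (\<Sum>k=m..<n. \<alpha> k)"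
          using A0 by (simp add: algebra_simps)
        also have "\<dots> < d / 2" using A c by (simp add: field_simps)
        finally show ?thesis using N1[of m n] m by auto
      qed
      finally have "dist (D (y n)) (D (y m)) < e"
        using d(2)[OF y y] by (simp add: dist_norm)
      with n(2) big show False by (simp add: dist_real_def)
    qed
    then show ?thesis unfolding eventually_sequentially by blast
  qed
  show ?thesis
  proof (rule tendstoI)
    fix e :: real assume "e > 0"
    then have "\<forall>\<^sub>F k in sequentially. D (y k) < 2 * (e / 2)" using small[of "e / 2"] by simp
    then show "\<forall>\<^sub>F k in sequentially. dist (D (y k)) 0 < e"
      by eventually_elim (use D0[OF y] in auto)
  qed
qed

section \<open>Uniform constants on a compact set\<close>

text \<open>Finitely many of the balls in \<open>cond_L\<close> cover \<open>X\<close>. Their moduli are combined as the root of the sum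
of squares, so that the square of \<open>L\<close> is visibly integrable. The sum may be infinite on a null
set, where \<open>enn2real\<close> turns it into zero and the bound is lost.\<close>

lemma uniform_subgradient_bound:
  fixes f :: "'a::euclidean_space \<Rightarrow> 's \<Rightarrow> real"
  assumes X: "compact X" and L: "cond_L P X f"
  obtains L :: "'s \<Rightarrow> real" where "L \<in> borel_measurable P" "integrable P (\<lambda>s. (L s)\<^sup>2)"
    "\<And>s. L s \<ge> 0" "AE s in P. \<forall>x\<in>X. \<forall>g\<in>frechet_subdiff (\<lambda>z. ereal (f z s)) x. norm g \<le> L s"
proof -
  obtain r where r: "r > 0" and meas: "\<And>u. u \<in> X \<Longrightarrow> local_lip X f r u \<in> borel_measurable P"
    and fin: "\<And>u. u \<in> X \<Longrightarrow> (\<integral>\<^sup>+ s. (local_lip X f r u s)\<^sup>2 \<partial>P) < \<infinity>"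
    using L unfolding cond_L_def by (meson order_refl)
  obtain U where U: "finite U" "U \<subseteq> X" "X \<subseteq> (\<Union>u\<in>U. ball u r)"
    using compact_finite_ball_cover[OF X r] by blast
  define Q where "Q s = (\<Sum>u\<in>U. (local_lip X f r u s)\<^sup>2)" for s
  have Qm[measurable]: "Q \<in> borel_measurable P"
    unfolding Q_def using meas U(2) by (intro borel_measurable_sum borel_measurable_power) auto
  have "(\<integral>\<^sup>+ s. Q s \<partial>P) = (\<Sum>u\<in>U. \<integral>\<^sup>+ s. (local_lip X f r u s)\<^sup>2 \<partial>P)"
    unfolding Q_def using meas U(2) by (intro nn_integral_sum borel_measurable_power) auto
  also have "\<dots> < \<infinity>" using fin U by (auto simp: less_top)
  finally have Qfin: "(\<integral>\<^sup>+ s. Q s \<partial>P) < \<infinity>" .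
  define L where "L s = sqrt (enn2real (Q s))" for s
  show thesis
  proof
    show Lm: "L \<in> borel_measurable P" unfolding L_def by measurable
    have "(\<integral>\<^sup>+ s. ennreal (enn2real (Q s)) \<partial>P) \<le> (\<integral>\<^sup>+ s. Q s \<partial>P)"
      by (intro nn_integral_mono) (simp add: ennreal_enn2real_if)
    with Qfin have "integrable P (\<lambda>s. enn2real (Q s))"
      by (intro integrableI_nonneg) auto
    then show "integrable P (\<lambda>s. (L s)\<^sup>2)" by (simp add: L_def)
    show "L s \<ge> 0" for s by (simp add: L_def)
    have "AE s in P. Q s \<noteq> \<infinity>"
      using Qfin by (intro nn_integral_PInf_AE) auto
    then show "AE s in P. \<forall>x\<in>X. \<forall>g\<in>frechet_subdiff (\<lambda>z. ereal (f z s)) x. norm g \<le> L s"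
    proof eventually_elim
      case (elim s)
      show ?case
      proof (intro ballI)
        fix x g assume x: "x \<in> X" and g: "g \<in> frechet_subdiff (\<lambda>z. ereal (f z s)) x"
        then obtain u where u: "u \<in> U" "x \<in> ball u r" using U(3) by auto
        have "ennreal (norm g) \<le> local_lip X f r u s"
          unfolding local_lip_def
          by (rule SUP_upper2[of x], use x u in \<open>simp add: dist_norm norm_minus_commute\<close>, rule SUP_upper[OF g])
        then have "(ennreal (norm g))\<^sup>2 \<le> (local_lip X f r u s)\<^sup>2" by (rule power_mono) simp
        also have "\<dots> \<le> Q s" unfolding Q_def using u(1) U(1) by (intro member_le_sum) auto
        finally have "ennreal ((norm g)\<^sup>2) \<le> ennreal (enn2real (Q s))"
          using elim by (simp add: ennreal_power less_top)
        then have "(norm g)\<^sup>2 \<le> enn2real (Q s)" by simp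
        then show "norm g \<le> L s" unfolding L_def by (rule real_le_rsqrt)
      qed
    qed
  qed
qed

text \<open>Cover \<open>X\<close> by balls of half the radius in \<open>cond_C4\<close>, so that a point near \<open>x\<close> lies in the same full
ball as \<open>x\<close>.\<close>

lemma uniform_model_upper_bound:
  fixes f :: "'a::euclidean_space \<Rightarrow> 's \<Rightarrow> real"
  assumes X: "compact X" and C4: "cond_C4 P X f fm"
  obtains \<epsilon> \<delta> where "0 < \<epsilon>" "\<epsilon> \<le> 1" "integrable P \<delta>" "\<And>s. s \<in> space P \<Longrightarrow> \<delta> s \<ge> 0"
    "\<And>s x y. s \<in> space P \<Longrightarrow> x \<in> X \<Longrightarrow> norm (y - x) \<le> \<epsilon> \<Longrightarrow>
        fm x s y \<le> ereal (f y s + \<delta> s / 2 * (norm (y - x))\<^sup>2)"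
proof -
  obtain r where r: "r > 0" and ex: "\<And>u. u \<in> X \<Longrightarrow> \<exists>\<delta> :: 's \<Rightarrow> real. integrable P \<delta> \<and>
           (\<forall>s\<in>space P. \<delta> s \<ge> 0 \<and>
              (\<forall>x\<in>X \<inter> cball u r. \<forall>y\<in>cball u r.
                 ereal (f y s) \<ge> fm x s y - ereal (1 / 2 * \<delta> s * (norm (y - x))\<^sup>2)))"
    using C4 unfolding cond_C4_def by (meson order_refl)
  from ex obtain d where d: "\<And>u. u \<in> X \<Longrightarrow> integrable P (d u)" "\<And>u s. u \<in> X \<Longrightarrow> s \<in> space P \<Longrightarrow> d u s \<ge> 0"
    and low: "\<And>u s x y. u \<in> X \<Longrightarrow> s \<in> space P \<Longrightarrow> x \<in> X \<inter> cball u r \<Longrightarrow> y \<in> cball u r \<Longrightarrow>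
      ereal (f y s) \<ge> fm x s y - ereal (1 / 2 * d u s * (norm (y - x))\<^sup>2)"
    by metis
  obtain U where U: "finite U" "U \<subseteq> X" "X \<subseteq> (\<Union>u\<in>U. ball u (r / 2))"
    using compact_finite_ball_cover[OF X, of "r / 2"] r by auto
  define \<delta> where "\<delta> s = (\<Sum>u\<in>U. d u s)" for s
  show thesis
  proof
    show "0 < min 1 (r / 2)" "min 1 (r / 2) \<le> 1" using r by auto
    show "integrable P \<delta>" unfolding \<delta>_def using d U by (intro Bochner_Integration.integrable_sum) auto
    show "\<delta> s \<ge> 0" if "s \<in> space P" for s
      unfolding \<delta>_def using d U that by (intro sum_nonneg) auto
    fix s x y assume s: "s \<in> space P" and x: "x \<in> X" and xy: "norm (y - x) \<le> min 1 (r / 2)"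
    obtain u where u: "u \<in> U" "x \<in> ball u (r / 2)" using U(3) x by auto
    then have uX: "u \<in> X" using U by auto
    have "dist u y \<le> dist u x + dist x y" by (rule dist_triangle)
    then have "y \<in> cball u r" "x \<in> X \<inter> cball u r"
      using u xy x r by (auto simp: dist_norm norm_minus_commute)
    from low[OF uX s this(2,1)] have "fm x s y \<le> ereal (f y s + d u s / 2 * (norm (y - x))\<^sup>2)"
      by (cases "fm x s y") auto
    also have "\<dots> \<le> ereal (f y s + \<delta> s / 2 * (norm (y - x))\<^sup>2)"
      unfolding \<delta>_def using u U d s
      by (auto intro!: add_left_mono mult_right_mono divide_right_mono member_le_sum)
    finally show "fm x s y \<le> ereal (f y s + \<delta> s / 2 * (norm (y - x))\<^sup>2)" .
  qed
qed

section \<open>Descent of the envelope along the method\<close>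

text \<open>What the descent argument uses of the method: uniform constants \<open>L\<close>, \<open>\<delta>\<close>, \<open>\<epsilon>\<close> in place of the local
conditions, with \<open>\<Delta>\<close> bounding the diameter of \<open>X\<close> and \<open>K\<close> a Lipschitz constant of \<open>\<phi>\<close> on \<open>X\<close>.\<close>

locale stochastic_model_method =
  fixes P :: "'s measure" and M :: "'w measure" and X :: "'a::euclidean_space set"
    and \<phi> :: "'a \<Rightarrow> real" and f :: "'a \<Rightarrow> 's \<Rightarrow> real" and fm :: "'a \<Rightarrow> 's \<Rightarrow> 'a \<Rightarrow> ereal"
    and S :: "nat \<Rightarrow> 'w \<Rightarrow> 's" and \<alpha> :: "nat \<Rightarrow> real" and x :: "nat \<Rightarrow> 'w \<Rightarrow> 'a"
    and L \<delta> :: "'s \<Rightarrow> real" and \<epsilon> K \<Delta> :: real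
  assumes prob_P: "prob_space P" and prob_M: "prob_space M"
    and compact_X: "compact X" and X_nonempty: "X \<noteq> {}" and convex_X: "convex X"
    and diam: "\<And>y z. y \<in> X \<Longrightarrow> z \<in> X \<Longrightarrow> norm (y - z) \<le> \<Delta>"
    and \<phi>_convex: "convex_on UNIV \<phi>"
    and K_nonneg: "K \<ge> 0" and \<phi>_lip: "\<And>y z. y \<in> X \<Longrightarrow> z \<in> X \<Longrightarrow> \<phi> y - \<phi> z \<le> K * norm (y - z)"
    and f_integrable: "\<And>y. integrable P (f y)"
    and L_meas: "L \<in> borel_measurable P" and L_sq: "integrable P (\<lambda>s. (L s)\<^sup>2)" and L_nonneg: "\<And>s. L s \<ge> 0"
    and \<epsilon>_pos: "\<epsilon> > 0" and \<epsilon>_le_1: "\<epsilon> \<le> 1"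
    and \<delta>_integrable: "integrable P \<delta>" and \<delta>_nonneg: "\<And>s. s \<in> space P \<Longrightarrow> \<delta> s \<ge> 0"
    and model_convex: "\<And>y s. y \<in> X \<Longrightarrow> s \<in> space P \<Longrightarrow> convex_ereal (fm y s)"
    and model_proper: "\<And>y s z. y \<in> X \<Longrightarrow> s \<in> space P \<Longrightarrow> fm y s z \<noteq> -\<infinity>"
    and model_centre: "\<And>y s. y \<in> X \<Longrightarrow> s \<in> space P \<Longrightarrow> fm y s y = ereal (f y s)"
    and model_lower: "AE s in P. \<forall>y\<in>X. \<forall>z. fm y s z \<ge> ereal (f y s - L s * norm (z - y))"
    and model_upper: "\<And>s y z. s \<in> space P \<Longrightarrow> y \<in> X \<Longrightarrow> norm (z - y) \<le> \<epsilon> \<Longrightarrow>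
        fm y s z \<le> ereal (f z s + \<delta> s / 2 * (norm (z - y))\<^sup>2)"
    and \<alpha>_pos: "\<And>k. \<alpha> k > 0" and \<alpha>_sum: "\<not> summable \<alpha>" and \<alpha>_sq: "summable (\<lambda>k. (\<alpha> k)\<^sup>2)"
    and iid: "iid_samples M P S"
    and iterate_in: "\<And>k \<omega>. \<omega> \<in> space M \<Longrightarrow> x k \<omega> \<in> X"
    and iterate_past: "\<And>k. x k \<in> borel_measurable (past M P S k)"
    and iterate_step: "\<And>k \<omega>. \<omega> \<in> space M \<Longrightarrow> is_arg_min
          (\<lambda>y. fm (x k \<omega>) (S k \<omega>) y + ereal (\<phi> y) + ereal (1 / (2 * \<alpha> k) * (norm (y - x k \<omega>))\<^sup>2))
          (\<lambda>y. y \<in> X) (x (Suc k) \<omega>)"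
begin

sublocale P: prob_space P by (rule prob_P)
sublocale M: prob_space M by (rule prob_M)

abbreviation F :: "'a \<Rightarrow> real" where "F \<equiv> objective P f \<phi>"

definition regular :: "'s \<Rightarrow> bool" where
  "regular s \<longleftrightarrow> s \<in> space P \<and> (\<forall>y\<in>X. \<forall>z. fm y s z \<ge> ereal (f y s - L s * norm (z - y)))"

lemma AE_regular: "AE s in P. regular s"
  using model_lower AE_space unfolding regular_def by eventually_elim auto

lemma diam_nonneg: "\<Delta> \<ge> 0"
  using X_nonempty diam norm_ge_zero order_trans by blast

lemma L_integrable: "integrable P L"
  by (rule P.square_integrable_imp_integrable[OF L_meas L_sq])

lemma L_plus_K_sq_integrable: "integrable P (\<lambda>s. (L s + K)\<^sup>2)"
  using L_sq L_integrable by (simp add: power2_sum)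

text \<open>The model centred at \<open>y\<close> lies between \<open>f y s - L s |z - y|\<close> and \<open>f z s + \<delta> s / 2 |z - y|^2\<close>, and
\<open>|z - y|^2 \<le> |z - y|\<close> since \<open>\<epsilon> \<le> 1\<close>.\<close>

lemma loss_diff:
  assumes s: "regular s" and xy: "y \<in> X" "norm (z - y) \<le> \<epsilon>"
  shows "f y s - f z s \<le> (L s + \<delta> s) * norm (z - y)"
proof -
  have sP: "s \<in> space P" using s by (simp add: regular_def)
  have "ereal (f y s - L s * norm (z - y)) \<le> fm y s z" using s xy(1) by (simp add: regular_def)
  also have "\<dots> \<le> ereal (f z s + \<delta> s / 2 * (norm (z - y))\<^sup>2)" by (rule model_upper[OF sP xy])
  finally have "f y s - L s * norm (z - y) \<le> f z s + \<delta> s / 2 * (norm (z - y))\<^sup>2" by simp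
  also have "\<delta> s / 2 * (norm (z - y))\<^sup>2 \<le> \<delta> s * norm (z - y)"
  proof -
    have "(norm (z - y))\<^sup>2 \<le> norm (z - y)"
      using xy(2) \<epsilon>_le_1 by (simp add: power2_eq_square mult_left_le)
    then have "\<delta> s / 2 * (norm (z - y))\<^sup>2 \<le> \<delta> s / 2 * norm (z - y)"
      using \<delta>_nonneg[OF sP] by (intro mult_left_mono) auto
    also have "\<dots> \<le> \<delta> s * norm (z - y)" using \<delta>_nonneg[OF sP] by (simp add: mult_right_mono)
    finally show ?thesis .
  qed
  finally show ?thesis by (simp add: algebra_simps)
qed

lemma objective_diff:
  assumes yz: "y \<in> X" "z \<in> X" "norm (z - y) \<le> \<epsilon>"
  shows "F y - F z \<le> ((\<integral>s. L s + \<delta> s \<partial>P) + K) * norm (z - y)"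
proof -
  have "mean_loss P f y - mean_loss P f z = (\<integral>s. f y s - f z s \<partial>P)"
    unfolding mean_loss_def using f_integrable by simp
  also have "\<dots> \<le> (\<integral>s. (L s + \<delta> s) * norm (z - y) \<partial>P)"
  proof (rule integral_mono_AE)
    show "AE s in P. f y s - f z s \<le> (L s + \<delta> s) * norm (z - y)"
      using AE_regular by eventually_elim (rule loss_diff[OF _ yz(1,3)])
  qed (use f_integrable L_integrable \<delta>_integrable in auto)
  also have "\<dots> = (\<integral>s. L s + \<delta> s \<partial>P) * norm (z - y)" by simp
  finally show ?thesis
    using \<phi>_lip[OF yz(1,2)] unfolding objective_def by (simp add: norm_minus_commute algebra_simps)
qed

lemma objective_continuous: "continuous_on X F"
  unfolding continuous_on_iff
proof (intro ballI allI impI)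
  fix y and e :: real assume y: "y \<in> X" and e: "e > 0"
  define C where "C = (\<integral>s. L s + \<delta> s \<partial>P) + K"
  have C: "C \<ge> 0" unfolding C_def using K_nonneg L_nonneg \<delta>_nonneg
    by (intro add_nonneg_nonneg integral_nonneg_AE AE_I2) auto
  show "\<exists>d>0. \<forall>z\<in>X. dist z y < d \<longrightarrow> dist (F z) (F y) < e"
  proof (intro exI conjI ballI impI)
    show "min \<epsilon> (e / (C + 1)) > 0" using e C \<epsilon>_pos by simp
    fix z assume z: "z \<in> X" and d: "dist z y < min \<epsilon> (e / (C + 1))"
    have "\<bar>F z - F y\<bar> \<le> C * norm (z - y)"
      using objective_diff[OF y z] objective_diff[OF z y] d unfolding C_def[symmetric]
      by (auto simp: dist_norm norm_minus_commute abs_le_iff)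
    also have "\<dots> \<le> (C + 1) * norm (z - y)" by (simp add: mult_right_mono)
    also have "\<dots> < e" using d C by (simp add: dist_norm pos_less_divide_eq mult.commute)
    finally show "dist (F z) (F y) < e" by (simp add: dist_real_def)
  qed
qed

lemma regular_samples: "AE \<omega> in M. \<forall>k. regular (S k \<omega>)"
  by (rule iid_samples_AE[OF prob_M iid AE_regular])

lemma step_length:
  assumes \<omega>: "\<omega> \<in> space M" and s: "regular (S k \<omega>)"
  shows "norm (x (Suc k) \<omega> - x k \<omega>) \<le> \<alpha> k * (L (S k \<omega>) + K)"
proof (rule model_step_length[OF convex_X _ _ \<phi>_convex \<alpha>_pos iterate_step[OF \<omega>] iterate_in[OF \<omega>]])
  show "\<phi> (x k \<omega>) - \<phi> y \<le> K * norm (y - x k \<omega>)" if "y \<in> X" for y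
    using \<phi>_lip[OF iterate_in[OF \<omega>] that] by (simp add: norm_minus_commute)
qed (use s iterate_in[OF \<omega>] model_convex model_proper model_centre L_nonneg K_nonneg in \<open>auto simp: regular_def\<close>)

text \<open>\<open>model_step_distance\<close> for the step from \<open>x k\<close>, with every occurrence of \<open>x k\<close> in the bound replaced by
a nearby point \<open>u\<close>; the terms with \<open>\<eta>\<close> pay for the replacement.\<close>

lemma step_towards:
  assumes \<omega>: "\<omega> \<in> space M" and s: "regular (S k \<omega>)" and u: "u \<in> X" and v: "v \<in> X"
    and xu: "norm (x k \<omega> - u) \<le> \<eta>" and \<eta>: "\<eta> \<le> \<epsilon> / 2" and vu: "norm (v - u) \<le> \<epsilon> / 2"
  shows "(norm (v - x (Suc k) \<omega>))\<^sup>2 \<le> (norm (v - u))\<^sup>2 + 2 * \<Delta> * \<eta>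
    + 2 * \<alpha> k * (f v (S k \<omega>) - f u (S k \<omega>) + \<phi> v - \<phi> u + \<delta> (S k \<omega>) / 2 * (norm (v - u))\<^sup>2
        + \<eta> * (L (S k \<omega>) + K + \<delta> (S k \<omega>) * (1 + \<Delta>)))
    + (\<alpha> k)\<^sup>2 * (L (S k \<omega>) + K)\<^sup>2"
proof -
  let ?s = "S k \<omega>" and ?x = "x k \<omega>"
  have sP: "?s \<in> space P" using s by (simp add: regular_def)
  note xX = iterate_in[OF \<omega>, of k]
  note d0 = \<delta>_nonneg[OF sP]
  have vx: "norm (v - ?x) \<le> \<epsilon>"
    using norm_triangle_ineq[of "v - u" "u - ?x"] xu \<eta> vu by (simp add: norm_minus_commute)
  have near: "(norm (v - ?x))\<^sup>2 \<le> (norm (v - u))\<^sup>2 + 2 * \<Delta> * \<eta>"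
    using norm_power2_diff_le[OF diam[OF v xX] diam[OF v u]] mult_left_mono[OF xu, of "2 * \<Delta>"] diam_nonneg
    by linarith
  have "(norm (v - x (Suc k) \<omega>))\<^sup>2 \<le> (norm (v - ?x))\<^sup>2
      + 2 * \<alpha> k * (f v ?s + \<delta> ?s / 2 * (norm (v - ?x))\<^sup>2 - f ?x ?s + \<phi> v - \<phi> ?x) + (\<alpha> k)\<^sup>2 * (L ?s + K)\<^sup>2"
  proof (rule model_step_distance[OF convex_X _ _ \<phi>_convex \<alpha>_pos iterate_step[OF \<omega>] xX])
    show "\<phi> ?x - \<phi> y \<le> K * norm (y - ?x)" if "y \<in> X" for y
      using \<phi>_lip[OF xX that] by (simp add: norm_minus_commute)
    show "fm ?x ?s v \<le> ereal (f v ?s + \<delta> ?s / 2 * (norm (v - ?x))\<^sup>2)"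
      by (rule model_upper[OF sP xX vx])
  qed (use s v xX model_convex model_proper model_centre L_nonneg K_nonneg in \<open>auto simp: regular_def\<close>)
  moreover have "f v ?s + \<delta> ?s / 2 * (norm (v - ?x))\<^sup>2 - f ?x ?s + \<phi> v - \<phi> ?x
      \<le> f v ?s - f u ?s + \<phi> v - \<phi> u + \<delta> ?s / 2 * (norm (v - u))\<^sup>2 + \<eta> * (L ?s + K + \<delta> ?s * (1 + \<Delta>))"
  proof -
    have "f u ?s - f ?x ?s \<le> (L ?s + \<delta> ?s) * norm (?x - u)"
      using xu \<eta> \<epsilon>_pos by (intro loss_diff[OF s u]) auto
    also have "\<dots> \<le> (L ?s + \<delta> ?s) * \<eta>"
      using xu d0 L_nonneg by (intro mult_left_mono) auto
    finally have 1: "f u ?s - f ?x ?s \<le> (L ?s + \<delta> ?s) * \<eta>" .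
    have "\<phi> u - \<phi> ?x \<le> K * norm (?x - u)" using \<phi>_lip[OF u xX] by (simp add: norm_minus_commute)
    also have "\<dots> \<le> K * \<eta>" using xu K_nonneg by (intro mult_left_mono)
    finally have 2: "\<phi> u - \<phi> ?x \<le> K * \<eta>" .
    have 3: "\<delta> ?s / 2 * (norm (v - ?x))\<^sup>2 \<le> \<delta> ?s / 2 * ((norm (v - u))\<^sup>2 + 2 * \<Delta> * \<eta>)"
      using near d0 by (intro mult_left_mono) auto
    from 1 2 3 show ?thesis by (simp add: algebra_simps)
  qed
  then have "2 * \<alpha> k * (f v ?s + \<delta> ?s / 2 * (norm (v - ?x))\<^sup>2 - f ?x ?s + \<phi> v - \<phi> ?x)
      \<le> 2 * \<alpha> k * (f v ?s - f u ?s + \<phi> v - \<phi> u + \<delta> ?s / 2 * (norm (v - u))\<^sup>2 + \<eta> * (L ?s + K + \<delta> ?s * (1 + \<Delta>)))"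
    using \<alpha>_pos[of k] by (intro mult_left_mono) auto
  ultimately show ?thesis using near by linarith
qed

abbreviation env :: "real \<Rightarrow> 'a \<Rightarrow> real" where "env \<rho> \<equiv> envelope F X \<rho>"

definition gap :: "real \<Rightarrow> 'a \<Rightarrow> real" where "gap \<rho> y = F y - env \<rho> y"

lemmas prox_in_X = prox_in[OF compact_X X_nonempty objective_continuous]
lemmas env_le = envelope_le[OF compact_X X_nonempty objective_continuous]
lemmas env_lipschitz = envelope_lipschitz[OF compact_X X_nonempty objective_continuous _ diam]

lemma gap_nonneg: "y \<in> X \<Longrightarrow> gap \<rho> y \<ge> 0"
  using env_le[of y \<rho> y] by (simp add: gap_def)

lemma env_continuous:
  assumes "\<rho> \<ge> 0" shows "continuous_on X (env \<rho>)"
proof (rule lipschitz_on_continuous_on)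
  show "(\<rho> * \<Delta>)-lipschitz_on X (env \<rho>)"
    using env_lipschitz[OF assms] assms diam_nonneg
    by (intro lipschitz_onI) (auto simp: dist_norm)
qed

lemma gap_continuous: "\<rho> \<ge> 0 \<Longrightarrow> continuous_on X (gap \<rho>)"
  unfolding gap_def by (intro continuous_intros objective_continuous env_continuous)

lemma iterate_measurable:
  fixes h :: "'a \<Rightarrow> real"
  assumes "continuous_on X h"
  shows "(\<lambda>\<omega>. h (x k \<omega>)) \<in> borel_measurable (past M P S k)"
proof -
  have "x k \<in> measurable (past M P S k) (restrict_space borel X)"
    using iterate_past iterate_in by (intro measurable_restrict_space2) (auto simp: past_def)
  from measurable_compose[OF this borel_measurable_continuous_on_restrict[OF assms]] show ?thesis .
qed

lemma iterate_integrable: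
  fixes h :: "'a \<Rightarrow> real"
  assumes "continuous_on X h"
  shows "integrable M (\<lambda>\<omega>. h (x k \<omega>))"
proof -
  have "bounded (h ` X)"
    by (intro compact_imp_bounded compact_continuous_image assms compact_X)
  then obtain B where "\<And>y. y \<in> X \<Longrightarrow> norm (h y) \<le> B"
    unfolding bounded_iff by auto
  with measurable_from_subalg[OF subalgebra_past iterate_measurable[OF assms]] show ?thesis
    using iid_samples_measurable[OF prob_M iid] iterate_in
    by (intro M.integrable_const_bound[where B=B]) auto
qed

text \<open>The model bound \<open>model_upper\<close> is available only within \<open>\<epsilon>\<close> of the centre, so \<open>\<rho>\<close> has to keep proximal
points close. With \<open>|F| \<le> B\<close> on \<open>X\<close> the proximal point satisfies \<open>\<rho>/2 |v - u|^2 \<le> 2B\<close>, hence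
\<open>\<rho> \<ge> 16 B / \<epsilon>^2\<close> suffices.\<close>

lemma prox_close:
  obtains \<rho> where "\<rho> > 0" "\<rho> \<ge> (\<integral>s. \<delta> s \<partial>P)" "\<And>u. u \<in> X \<Longrightarrow> norm (prox F X \<rho> u - u) \<le> \<epsilon> / 2"
proof -
  have "bounded (F ` X)"
    by (intro compact_imp_bounded compact_continuous_image objective_continuous compact_X)
  then obtain B where B: "\<And>y. y \<in> X \<Longrightarrow> \<bar>F y\<bar> \<le> B"
    unfolding bounded_iff by auto
  have B0: "B \<ge> 0" using B X_nonempty abs_ge_zero order_trans by blast
  define \<rho> where "\<rho> = max (\<integral>s. \<delta> s \<partial>P) (16 * B / \<epsilon>\<^sup>2) + 1"
  have \<rho>: "\<rho> \<ge> 16 * B / \<epsilon>\<^sup>2" "\<rho> > 0"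
  proof -
    have "16 * B / \<epsilon>\<^sup>2 \<ge> 0" using B0 by simp
    then show "\<rho> \<ge> 16 * B / \<epsilon>\<^sup>2" "\<rho> > 0" unfolding \<rho>_def by linarith+
  qed
  show thesis
  proof
    show "\<rho> > 0" by (rule \<rho>)
    show "\<rho> \<ge> (\<integral>s. \<delta> s \<partial>P)" unfolding \<rho>_def by linarith
    fix u assume u: "u \<in> X"
    let ?v = "prox F X \<rho> u"
    have "F ?v + \<rho> / 2 * (norm (?v - u))\<^sup>2 \<le> F u"
      using env_le[OF u, of \<rho> u] by (simp add: envelope_def)
    then have "\<rho> / 2 * (norm (?v - u))\<^sup>2 \<le> 2 * B"
      using B[OF u] B[OF prox_in_X, of \<rho> u] by (auto simp: abs_le_iff)
    then have "\<rho> * (norm (?v - u))\<^sup>2 \<le> 4 * B" by simp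
    also have "4 * B \<le> \<rho> * (\<epsilon> / 2)\<^sup>2"
      using \<rho>(1) \<epsilon>_pos by (simp add: power_divide pos_divide_le_eq)
    finally have "(norm (?v - u))\<^sup>2 \<le> (\<epsilon> / 2)\<^sup>2"
      using \<rho>(2) by simp
    then show "norm (?v - u) \<le> \<epsilon> / 2"
      using \<epsilon>_pos by (auto elim: power2_le_imp_le)
  qed
qed

text \<open>The comparison point in \<open>step_towards\<close> is the proximal point \<open>v\<close> of a net point \<open>u\<close> near \<open>x k\<close>. Given
the past it is fixed, so the sample can be averaged out, and \<open>\<rho> \<ge> E[\<delta>]\<close> bounds the mean of the
bracket by \<open>-gap u\<close>, up to the terms with \<open>\<eta>\<close>. The mesh \<open>\<eta>\<close> of the net is at most both \<open>\<alpha> k\<close> and \<open>(\<alpha> k)^2\<close>, so that replacing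
\<open>x k\<close> by \<open>u\<close> costs only \<open>O((\<alpha> k)^2)\<close>, whether the replacement enters with or without the
factor \<open>\<alpha> k\<close>.\<close>

lemma expected_decrease:
  assumes \<rho>: "\<rho> > 0" "\<rho> \<ge> (\<integral>s. \<delta> s \<partial>P)" and close: "\<And>u. u \<in> X \<Longrightarrow> norm (prox F X \<rho> u - u) \<le> \<epsilon> / 2"
  obtains C where "\<And>k. AE \<omega> in M. real_cond_exp M (past M P S k) (\<lambda>\<omega>. env \<rho> (x (Suc k) \<omega>)) \<omega>
      \<le> env \<rho> (x k \<omega>) - \<rho> * \<alpha> k * gap \<rho> (x k \<omega>) + C * (\<alpha> k)\<^sup>2"
proof -
  define d where "d = (\<integral>s. \<delta> s \<partial>P)"
  define l where "l = (\<integral>s. L s \<partial>P)"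
  define g2 where "g2 = (\<integral>s. (L s + K)\<^sup>2 \<partial>P)"
  have d0: "d \<ge> 0" unfolding d_def using \<delta>_nonneg by (intro integral_nonneg_AE AE_I2) auto
  have l0: "l \<ge> 0" unfolding l_def using L_nonneg by (intro integral_nonneg_AE AE_I2) auto
  define R where "R = l + d + K + \<rho> * \<Delta>"
  define C where "C = 2 * (\<rho> * \<Delta>) + \<rho> * (l + K + d * (1 + \<Delta>)) + \<rho> * R + \<rho> / 2 * g2"
  have R0: "R \<ge> 0" unfolding R_def using l0 d0 K_nonneg \<rho> diam_nonneg by auto
  show thesis
  proof (rule that[of C])
    fix k
    define a where "a = \<alpha> k"
    have a: "a > 0" unfolding a_def by (rule \<alpha>_pos)
    define \<eta> where "\<eta> = min (\<epsilon> / 2) (min a (a\<^sup>2))"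
    have \<eta>: "\<eta> > 0" "\<eta> \<le> \<epsilon> / 2" "\<eta> \<le> a" "\<eta> \<le> a\<^sup>2"
      unfolding \<eta>_def using \<epsilon>_pos a by auto
    obtain U sel where U: "finite U" "U \<subseteq> X" and sel_m: "sel \<in> measurable borel (count_space UNIV)"
      and sel: "\<And>y. y \<in> X \<Longrightarrow> sel y \<in> U \<and> norm (y - sel y) < \<eta>"
      using finite_measurable_net[OF compact_X \<eta>(1)] by blast
    define v where "v = prox F X \<rho>"
    have vX: "v u \<in> X" for u unfolding v_def by (rule prox_in_X)
    have venv: "F (v u) + \<rho> / 2 * (norm (v u - u))\<^sup>2 = env \<rho> u" for u
      unfolding v_def envelope_def ..
    define \<psi> where "\<psi> u s = 2 * (\<rho> * \<Delta>) * \<eta>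
      + \<rho> * a * (f (v u) s - f u s + \<phi> (v u) - \<phi> u + \<delta> s / 2 * (norm (v u - u))\<^sup>2
          + \<eta> * (L s + K + \<delta> s * (1 + \<Delta>)))
      + \<rho> / 2 * (a\<^sup>2 * (L s + K)\<^sup>2)" for u s
    have \<psi>_int: "integrable P (\<psi> u)" for u
      unfolding \<psi>_def using f_integrable L_integrable \<delta>_integrable L_plus_K_sq_integrable by auto
    have \<psi>_mean: "(\<integral>s. \<psi> u s \<partial>P) = 2 * (\<rho> * \<Delta>) * \<eta>
      + \<rho> * a * (F (v u) - F u + d / 2 * (norm (v u - u))\<^sup>2 + \<eta> * (l + K + d * (1 + \<Delta>)))
      + \<rho> / 2 * (a\<^sup>2 * g2)" for u
      unfolding \<psi>_def d_def l_def g2_def objective_def mean_loss_def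
      using f_integrable L_integrable \<delta>_integrable L_plus_K_sq_integrable by (simp add: P.prob_space algebra_simps)
    have "AE \<omega> in M. real_cond_exp M (past M P S k) (\<lambda>\<omega>. env \<rho> (x (Suc k) \<omega>)) \<omega>
        \<le> env \<rho> (x k \<omega>) + (\<integral>s. \<psi> (sel (x k \<omega>)) s \<partial>P)"
    proof (rule real_cond_exp_le_selected[OF prob_M iid U(1)])
      show "sel (x k \<omega>) \<in> U" if "\<omega> \<in> space M" for \<omega>
        using sel[OF iterate_in[OF that]] by blast
      show "(\<lambda>\<omega>. sel (x k \<omega>)) \<in> measurable (past M P S k) (count_space UNIV)"
        by (rule measurable_compose[OF iterate_past sel_m])
      show "integrable P (\<psi> u)" for u by (rule \<psi>_int)
      show ePast: "(\<lambda>\<omega>. env \<rho> (x k \<omega>)) \<in> borel_measurable (past M P S k)"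
        using \<rho> by (intro iterate_measurable env_continuous) auto
      show "integrable M (\<lambda>\<omega>. env \<rho> (x k \<omega>))" "integrable M (\<lambda>\<omega>. env \<rho> (x (Suc k) \<omega>))"
        using \<rho> by (intro iterate_integrable env_continuous; simp)+
      show "AE \<omega> in M. env \<rho> (x (Suc k) \<omega>) \<le> env \<rho> (x k \<omega>) + \<psi> (sel (x k \<omega>)) (S k \<omega>)"
        using regular_samples AE_space
      proof eventually_elim
        case (elim \<omega>)
        let ?x = "x k \<omega>" and ?s = "S k \<omega>"
        define u where "u = sel ?x"
        have xX: "?x \<in> X" by (rule iterate_in[OF elim(2)])
        have u: "u \<in> X" "norm (?x - u) \<le> \<eta>" using sel[OF xX] U(2) unfolding u_def by auto
        have s: "regular ?s" using elim(1) by blast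
        have "env \<rho> (x (Suc k) \<omega>) \<le> F (v u) + \<rho> / 2 * (norm (v u - x (Suc k) \<omega>))\<^sup>2"
          by (rule env_le[OF vX])
        also have "\<dots> \<le> F (v u) + \<rho> / 2 * ((norm (v u - u))\<^sup>2 + 2 * \<Delta> * \<eta>
          + 2 * a * (f (v u) ?s - f u ?s + \<phi> (v u) - \<phi> u + \<delta> ?s / 2 * (norm (v u - u))\<^sup>2
            + \<eta> * (L ?s + K + \<delta> ?s * (1 + \<Delta>))) + a\<^sup>2 * (L ?s + K)\<^sup>2)"
          using step_towards[OF elim(2) s u(1) vX u(2) \<eta>(2)] close[OF u(1)] \<rho> unfolding a_def v_def
          by (intro add_left_mono mult_left_mono) auto
        also have "\<dots> = env \<rho> u - \<rho> * \<Delta> * \<eta> + \<psi> u ?s"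
          unfolding \<psi>_def venv[symmetric] by (simp add: algebra_simps)
        also have "env \<rho> u \<le> env \<rho> ?x + \<rho> * \<Delta> * \<eta>"
        proof -
          have "\<bar>env \<rho> u - env \<rho> ?x\<bar> \<le> \<rho> * \<Delta> * norm (u - ?x)"
            using \<rho> by (intro env_lipschitz u xX) auto
          also have "\<dots> \<le> \<rho> * \<Delta> * \<eta>"
            using u(2) \<rho> diam_nonneg by (intro mult_left_mono) (auto simp: norm_minus_commute)
          finally show ?thesis by linarith
        qed
        finally show ?case unfolding u_def by simp
      qed
    qed
    then show "AE \<omega> in M. real_cond_exp M (past M P S k) (\<lambda>\<omega>. env \<rho> (x (Suc k) \<omega>)) \<omega>
      \<le> env \<rho> (x k \<omega>) - \<rho> * \<alpha> k * gap \<rho> (x k \<omega>) + C * (\<alpha> k)\<^sup>2"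
      using AE_space
    proof eventually_elim
      case (elim \<omega>)
      let ?x = "x k \<omega>"
      define u where "u = sel ?x"
      have xX: "?x \<in> X" by (rule iterate_in[OF elim(2)])
      have u: "u \<in> X" "norm (?x - u) \<le> \<eta>" using sel[OF xX] U(2) unfolding u_def by auto
      have "F (v u) - F u + d / 2 * (norm (v u - u))\<^sup>2 \<le> - gap \<rho> u"
        using mult_right_mono[OF \<rho>(2), of "(norm (v u - u))\<^sup>2"] venv[of u] unfolding gap_def d_def by simp
      also have "- gap \<rho> u \<le> - gap \<rho> ?x + R * \<eta>"
      proof -
        have "F ?x - F u \<le> (l + d + K) * norm (u - ?x)"
          using objective_diff[OF xX u(1)] u(2) \<eta>(2) \<epsilon>_pos L_integrable \<delta>_integrable
          by (simp add: l_def d_def norm_minus_commute)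
        moreover have "\<bar>env \<rho> u - env \<rho> ?x\<bar> \<le> \<rho> * \<Delta> * norm (u - ?x)"
          using \<rho> by (intro env_lipschitz u xX) auto
        ultimately have "gap \<rho> ?x - gap \<rho> u \<le> R * norm (u - ?x)"
          unfolding gap_def R_def by (simp add: algebra_simps)
        also have "\<dots> \<le> R * \<eta>" using u(2) R0 by (intro mult_left_mono) (auto simp: norm_minus_commute)
        finally show ?thesis by simp
      qed
      finally have dec: "F (v u) - F u + d / 2 * (norm (v u - u))\<^sup>2 \<le> - gap \<rho> ?x + R * \<eta>" .
      define T where "T = l + K + d * (1 + \<Delta>)"
      have T0: "T \<ge> 0" unfolding T_def using l0 K_nonneg d0 diam_nonneg by auto
      have a\<eta>: "a * \<eta> \<le> a\<^sup>2" using \<eta>(3) a by (simp add: power2_eq_square)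
      have "(\<integral>s. \<psi> u s \<partial>P) \<le> 2 * (\<rho> * \<Delta>) * \<eta> + \<rho> * a * (- gap \<rho> ?x + R * \<eta> + \<eta> * T) + \<rho> / 2 * (a\<^sup>2 * g2)"
        unfolding \<psi>_mean T_def[symmetric]
        using mult_left_mono[OF add_right_mono[OF dec, of "\<eta> * T"], of "\<rho> * a"] \<rho> a by simp
      also have "\<dots> = 2 * (\<rho> * \<Delta>) * \<eta> + (\<rho> * (R + T)) * (a * \<eta>) - \<rho> * a * gap \<rho> ?x + \<rho> / 2 * (a\<^sup>2 * g2)"
        by (simp add: algebra_simps)
      also have "\<dots> \<le> 2 * (\<rho> * \<Delta>) * a\<^sup>2 + (\<rho> * (R + T)) * a\<^sup>2 - \<rho> * a * gap \<rho> ?x + \<rho> / 2 * (a\<^sup>2 * g2)"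
        using \<eta>(4) a\<eta> \<rho> R0 T0 diam_nonneg by (intro add_right_mono diff_right_mono add_mono mult_left_mono) auto
      also have "\<dots> = - \<rho> * a * gap \<rho> ?x + C * a\<^sup>2"
        unfolding C_def T_def by (simp add: algebra_simps)
      finally show ?case using elim(1) unfolding u_def a_def by simp
    qed
  qed
qed

lemma envelope_converges_and_gap_summable:
  assumes \<rho>: "\<rho> > 0" "\<rho> \<ge> (\<integral>s. \<delta> s \<partial>P)" and close: "\<And>u. u \<in> X \<Longrightarrow> norm (prox F X \<rho> u - u) \<le> \<epsilon> / 2"
  shows "AE \<omega> in M. convergent (\<lambda>k. env \<rho> (x k \<omega>)) \<and> summable (\<lambda>k. \<alpha> k * gap \<rho> (x k \<omega>))"
proof -
  obtain C where drift: "\<And>k. AE \<omega> in M. real_cond_exp M (past M P S k) (\<lambda>\<omega>. env \<rho> (x (Suc k) \<omega>)) \<omega>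
      \<le> env \<rho> (x k \<omega>) - \<rho> * \<alpha> k * gap \<rho> (x k \<omega>) + C * (\<alpha> k)\<^sup>2"
    using expected_decrease[OF \<rho> close] by blast
  have cont: "continuous_on X (env \<rho>)" using \<rho> by (intro env_continuous) auto
  have "bounded (env \<rho> ` X)"
    by (intro compact_imp_bounded compact_continuous_image cont compact_X)
  then obtain B where B: "\<And>y. y \<in> X \<Longrightarrow> \<bar>env \<rho> y\<bar> \<le> B"
    unfolding bounded_iff by auto
  note S = iid_samples_measurable[OF prob_M iid]
  have "AE \<omega> in M. convergent (\<lambda>k. env \<rho> (x k \<omega>)) \<and> summable (\<lambda>k. \<rho> * \<alpha> k * gap \<rho> (x k \<omega>))"
  proof (rule M.robbins_siegmund_bounded[where F="past M P S" and Y="\<lambda>k \<omega>. env \<rho> (x k \<omega>)"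
        and a="\<lambda>k. C * (\<alpha> k)\<^sup>2"])
    show "subalgebra M (past M P S k)" for k by (rule subalgebra_past[OF S])
    show "sets (past M P S m) \<subseteq> sets (past M P S n)" if "m \<le> n" for m n by (rule past_mono[OF S that])
    show "(\<lambda>\<omega>. env \<rho> (x k \<omega>)) \<in> borel_measurable (past M P S k)" for k by (rule iterate_measurable[OF cont])
    show "\<bar>env \<rho> (x k \<omega>)\<bar> \<le> B" if "\<omega> \<in> space M" for k \<omega> by (rule B[OF iterate_in[OF that]])
    show "(\<integral>\<omega>. (env \<rho> (x (Suc k) \<omega>) - env \<rho> (x k \<omega>))\<^sup>2 \<partial>M)
        \<le> ((\<rho> * \<Delta>)\<^sup>2 * (\<integral>s. (L s + K)\<^sup>2 \<partial>P)) * (\<alpha> k)\<^sup>2" for k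
    proof -
      have "(\<integral>\<omega>. (env \<rho> (x (Suc k) \<omega>) - env \<rho> (x k \<omega>))\<^sup>2 \<partial>M)
        \<le> (\<integral>\<omega>. (\<rho> * \<Delta> * \<alpha> k)\<^sup>2 * (L (S k \<omega>) + K)\<^sup>2 \<partial>M)"
      proof (rule integral_mono_AE')
        show "integrable M (\<lambda>\<omega>. (\<rho> * \<Delta> * \<alpha> k)\<^sup>2 * (L (S k \<omega>) + K)\<^sup>2)"
          using iid_samples_integral(1)[OF prob_M iid L_plus_K_sq_integrable] by simp
        show "AE \<omega> in M. (env \<rho> (x (Suc k) \<omega>) - env \<rho> (x k \<omega>))\<^sup>2 \<le> (\<rho> * \<Delta> * \<alpha> k)\<^sup>2 * (L (S k \<omega>) + K)\<^sup>2"
          using regular_samples AE_space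
        proof eventually_elim
          case (elim \<omega>)
          have "\<bar>env \<rho> (x (Suc k) \<omega>) - env \<rho> (x k \<omega>)\<bar> \<le> \<rho> * \<Delta> * norm (x (Suc k) \<omega> - x k \<omega>)"
            using \<rho> by (intro env_lipschitz iterate_in elim) auto
          also have "\<dots> \<le> \<rho> * \<Delta> * (\<alpha> k * (L (S k \<omega>) + K))"
            using \<rho> diam_nonneg step_length[OF elim(2), of k] elim(1) by (intro mult_left_mono) auto
          finally have "\<bar>env \<rho> (x (Suc k) \<omega>) - env \<rho> (x k \<omega>)\<bar>\<^sup>2 \<le> (\<rho> * \<Delta> * (\<alpha> k * (L (S k \<omega>) + K)))\<^sup>2"
            by (intro power_mono) auto
          then show ?case by (simp add: power_mult_distrib mult.assoc)
        qed
      qed simp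
      also have "\<dots> = ((\<rho> * \<Delta>)\<^sup>2 * (\<integral>s. (L s + K)\<^sup>2 \<partial>P)) * (\<alpha> k)\<^sup>2"
        using iid_samples_integral(2)[OF prob_M iid L_plus_K_sq_integrable] by (simp add: power_mult_distrib)
      finally show ?thesis .
    qed
    show "\<rho> * \<alpha> k * gap \<rho> (x k \<omega>) \<ge> 0" if "\<omega> \<in> space M" for k \<omega>
      using \<rho> \<alpha>_pos[of k] gap_nonneg[OF iterate_in[OF that], of \<rho> k] by simp
  qed (intro drift summable_mult \<alpha>_sq)+
  then show ?thesis
  proof eventually_elim
    case (elim \<omega>)
    then have "summable (\<lambda>k. (1 / \<rho>) * (\<rho> * \<alpha> k * gap \<rho> (x k \<omega>)))" by (intro summable_mult) auto
    then show ?case using elim \<rho> by simp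
  qed
qed

theorem objective_converges_and_limits_are_proximal:
  obtains \<rho> where "AE \<omega> in M. convergent (\<lambda>k. F (x k \<omega>)) \<and>
    (\<forall>z r. strict_mono r \<and> (\<lambda>k. x (r k) \<omega>) \<longlonglongrightarrow> z \<longrightarrow>
       z \<in> X \<and> (\<forall>y\<in>X. F z \<le> F y + \<rho> / 2 * (norm (y - z))\<^sup>2))"
proof -
  obtain \<rho> where \<rho>: "\<rho> > 0" "\<rho> \<ge> (\<integral>s. \<delta> s \<partial>P)" and close: "\<And>u. u \<in> X \<Longrightarrow> norm (prox F X \<rho> u - u) \<le> \<epsilon> / 2"
    using prox_close by blast
  define c where "c = (\<integral>s. L s + K \<partial>P)"
  have c0: "c \<ge> 0" unfolding c_def using L_nonneg K_nonneg by (intro integral_nonneg_AE AE_I2) auto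
  have noise: "AE \<omega> in M. summable (\<lambda>k. \<alpha> k * ((L (S k \<omega>) + K) - c))"
    unfolding c_def using L_meas
    by (intro summable_centred_noise[OF prob_M prob_P iid _ L_plus_K_sq_integrable \<alpha>_sq]) auto
  have env_gap: "AE \<omega> in M. convergent (\<lambda>k. env \<rho> (x k \<omega>)) \<and> summable (\<lambda>k. \<alpha> k * gap \<rho> (x k \<omega>))"
    using close by (intro envelope_converges_and_gap_summable \<rho>)
  have gcont: "continuous_on X (gap \<rho>)" using \<rho> by (intro gap_continuous) auto
  show thesis
  proof (rule that)
    show "AE \<omega> in M. convergent (\<lambda>k. F (x k \<omega>)) \<and>
      (\<forall>z r. strict_mono r \<and> (\<lambda>k. x (r k) \<omega>) \<longlonglongrightarrow> z \<longrightarrow>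
         z \<in> X \<and> (\<forall>y\<in>X. F z \<le> F y + \<rho> / 2 * (norm (y - z))\<^sup>2))"
      using noise env_gap regular_samples AE_space
    proof eventually_elim
      case (elim \<omega>)
      have gap0: "(\<lambda>k. gap \<rho> (x k \<omega>)) \<longlonglongrightarrow> 0"
      proof (rule potential_tendsto_zero[OF compact_X gcont gap_nonneg _ \<alpha>_pos \<alpha>_sum _ _ elim(1) c0])
        show "norm (x (Suc k) \<omega> - x k \<omega>) \<le> \<alpha> k * (L (S k \<omega>) + K)" for k
          using elim(3) by (intro step_length[OF elim(4)]) blast
      qed (use elim iterate_in in auto)
      have "convergent (\<lambda>k. gap \<rho> (x k \<omega>) + env \<rho> (x k \<omega>))"
        using gap0 elim(2) by (intro convergent_add convergentI[OF gap0]) auto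
      then have conv: "convergent (\<lambda>k. F (x k \<omega>))" by (simp add: gap_def)
      moreover have "z \<in> X \<and> (\<forall>y\<in>X. F z \<le> F y + \<rho> / 2 * (norm (y - z))\<^sup>2)"
        if r: "strict_mono r" and lim: "(\<lambda>k. x (r k) \<omega>) \<longlonglongrightarrow> z" for z and r :: "nat \<Rightarrow> nat"
      proof -
        have z: "z \<in> X"
          using closed_sequentially[OF compact_imp_closed[OF compact_X] _ lim] iterate_in[OF elim(4)] by blast
        have "(\<lambda>k. gap \<rho> (x (r k) \<omega>)) \<longlonglongrightarrow> gap \<rho> z"
          using continuous_on_tendsto_compose[OF gcont lim z] iterate_in[OF elim(4)] by auto
        moreover have "(\<lambda>k. gap \<rho> (x (r k) \<omega>)) \<longlonglongrightarrow> 0"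
          using LIMSEQ_subseq_LIMSEQ[OF gap0 r] by (simp add: comp_def)
        ultimately have "gap \<rho> z = 0" by (rule LIMSEQ_unique)
        then show ?thesis using z env_le[of _ \<rho> z] by (auto simp: gap_def)
      qed
      ultimately show ?case by blast
    qed
  qed
qed

end

section \<open>Weak convexity of the mean loss and the conclusion\<close>

lemma mean_loss_weakly_convex:
  assumes W: "cond_W P X f" and f: "\<And>y. integrable P (f y)" and z: "z \<in> X"
  obtains \<epsilon> l where "\<epsilon> > 0" "convex_on (cball z \<epsilon>) (\<lambda>y. mean_loss P f y + l / 2 * (norm (y - z))\<^sup>2)"
proof -
  obtain \<epsilon> where \<epsilon>: "\<epsilon> > 0" and "\<exists>lam :: _ \<Rightarrow> real. integrable P lam \<and>
           (\<forall>s\<in>space P. lam s \<ge> 0 \<and>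
              (\<forall>x0. convex_on (cball z \<epsilon>) (\<lambda>y. f y s + lam s / 2 * (norm (y - x0))\<^sup>2)))"
    using W z unfolding cond_W_def by (meson order_refl)
  then obtain lam where lam: "integrable P lam"
    and cvx: "\<And>s. s \<in> space P \<Longrightarrow> convex_on (cball z \<epsilon>) (\<lambda>y. f y s + lam s / 2 * (norm (y - z))\<^sup>2)"
    by blast
  define q where "q y s = f y s + lam s / 2 * (norm (y - z))\<^sup>2" for y s
  have q: "integrable P (q y)" for y unfolding q_def using f lam by auto
  have mean: "mean_loss P f y + (\<integral>s. lam s \<partial>P) / 2 * (norm (y - z))\<^sup>2 = (\<integral>s. q y s \<partial>P)" for y
    unfolding q_def mean_loss_def using f lam by simp
  show thesis
  proof (rule that[OF \<epsilon>, of "\<integral>s. lam s \<partial>P"])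
    show "convex_on (cball z \<epsilon>) (\<lambda>y. mean_loss P f y + (\<integral>s. lam s \<partial>P) / 2 * (norm (y - z))\<^sup>2)"
      unfolding mean
    proof (rule convex_onI)
      fix t :: real and y y' assume t: "0 < t" "t < 1" and y: "y \<in> cball z \<epsilon>" "y' \<in> cball z \<epsilon>"
      have "(\<integral>s. q ((1 - t) *\<^sub>R y + t *\<^sub>R y') s \<partial>P) \<le> (\<integral>s. (1 - t) * q y s + t * q y' s \<partial>P)"
      proof (rule integral_mono)
        show "q ((1 - t) *\<^sub>R y + t *\<^sub>R y') s \<le> (1 - t) * q y s + t * q y' s" if "s \<in> space P" for s
          unfolding q_def using t y by (intro convex_onD[OF cvx[OF that]]) auto
      qed (use q in auto)
      also have "\<dots> = (1 - t) * (\<integral>s. q y s \<partial>P) + t * (\<integral>s. q y' s \<partial>P)"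
        using q by simp
      finally show "(\<integral>s. q ((1 - t) *\<^sub>R y + t *\<^sub>R y') s \<partial>P) \<le> (1 - t) * (\<integral>s. q y s \<partial>P) + t * (\<integral>s. q y' s \<partial>P)" .
    qed (rule convex_cball)
  qed
qed

theorem corollary2p2:
  fixes P :: "'s measure" and M :: "'w measure"
    and X :: "'a::euclidean_space set"
    and \<phi> :: "'a \<Rightarrow> real" and f :: "'a \<Rightarrow> 's \<Rightarrow> real" and fm :: "'a \<Rightarrow> 's \<Rightarrow> 'a \<Rightarrow> ereal"
    and S :: "nat \<Rightarrow> 'w \<Rightarrow> 's" and \<alpha> :: "nat \<Rightarrow> real"
    and x0 :: 'a and x :: "nat \<Rightarrow> 'w \<Rightarrow> 'a"
  assumes "prob_space P"
    and "X \<noteq> {}" and "closed X" and "convex X"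
    and "convex_on UNIV \<phi>" and "closed (epigraph UNIV \<phi>)"
    and "\<And>y. integrable P (f y)"
    and "cond_L P X f"
    and "cond_W P X f"
    and "compact X"
    and "closure (- (objective P f \<phi> ` stationary_set P X f \<phi>)) = UNIV"
    and "\<And>y s z. y \<in> X \<Longrightarrow> s \<in> space P \<Longrightarrow> fm y s z \<noteq> -\<infinity>"
    and "\<And>y z. y \<in> X \<Longrightarrow> (\<lambda>s. fm y s z) \<in> borel_measurable P"
    and "cond_C1 P X fm"
    and "cond_C2 P X f fm"
    and "cond_C3 P X f fm"
    and "cond_C4 P X f fm"
    and "\<And>k. \<alpha> k > 0"
    and "\<not> summable \<alpha>"
    and "summable (\<lambda>k. (\<alpha> k)\<^sup>2)"
    and "prob_space M"
    and "iid_samples M P S"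
    and "x0 \<in> X"
    and "model_iteration M P X fm \<phi> \<alpha> S x0 x"
  shows "AE \<omega> in M.
           convergent (\<lambda>k. mean_loss P f (x k \<omega>) + \<phi> (x k \<omega>)) \<and>
           (\<forall>z r. strict_mono r \<and> (\<lambda>k. x (r k) \<omega>) \<longlonglongrightarrow> z
                    \<longrightarrow> z \<in> stationary_set P X f \<phi>)"
proof -
  have iterates: "x k \<omega> \<in> X" if "\<omega> \<in> space M" for k \<omega>
    using assms(23,24) that unfolding model_iteration_def is_arg_min_def by (cases k) auto
  obtain L where L: "L \<in> borel_measurable P" "integrable P (\<lambda>s. (L s)\<^sup>2)" "\<And>s. L s \<ge> 0"
    and Lb: "AE s in P. \<forall>x\<in>X. \<forall>g\<in>frechet_subdiff (\<lambda>z. ereal (f z s)) x. norm g \<le> L s"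
    using uniform_subgradient_bound[OF assms(10,8)] by blast
  obtain \<epsilon> \<delta> where \<epsilon>: "0 < \<epsilon>" "\<epsilon> \<le> 1" and \<delta>: "integrable P \<delta>" "\<And>s. s \<in> space P \<Longrightarrow> \<delta> s \<ge> 0"
    and up: "\<And>s x y. s \<in> space P \<Longrightarrow> x \<in> X \<Longrightarrow> norm (y - x) \<le> \<epsilon> \<Longrightarrow>
        fm x s y \<le> ereal (f y s + \<delta> s / 2 * (norm (y - x))\<^sup>2)"
    using uniform_model_upper_bound[OF assms(10,17)] by blast
  have bX: "bounded X" by (rule compact_imp_bounded[OF assms(10)])
  obtain K where K: "K \<ge> 0" "\<And>x y. x \<in> X \<Longrightarrow> y \<in> X \<Longrightarrow> \<phi> x - \<phi> y \<le> K * norm (x - y)"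
    using convex_on_imp_lower_lipschitz_on_bounded[OF assms(5) bX] by blast
  \<comment> \<open>A subgradient of the model at its centre is one of \<open>f(.;s)\<close>, hence bounded by \<open>L s\<close>, and it
    supports the convex model everywhere.\<close>
  have lower: "AE s in P. \<forall>y\<in>X. \<forall>z. fm y s z \<ge> ereal (f y s - L s * norm (z - y))"
    using Lb AE_space
  proof eventually_elim
    case (elim s)
    show ?case
    proof (intro ballI allI)
      fix y z assume y: "y \<in> X"
      have c: "fm y s y = ereal (f y s)" using assms(15) y elim(2) unfolding cond_C2_def by blast
      obtain g where g: "g \<in> frechet_subdiff (fm y s) y"
        using assms(14) y elim(2) c unfolding cond_C1_def by fastforce
      have "norm g \<le> L s" using elim g assms(16) y unfolding cond_C3_def by blast
      then have "- (g \<bullet> (z - y)) \<le> L s * norm (z - y)"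
        using Cauchy_Schwarz_ineq2[of g "z - y"] mult_right_mono[of "norm g" "L s" "norm (z - y)"] by auto
      then have "ereal (f y s - L s * norm (z - y)) \<le> fm y s y + ereal (g \<bullet> (z - y))"
        by (simp add: c)
      also have "\<dots> \<le> fm y s z"
        using assms(14) y elim(2) assms(12)[OF y elim(2)] unfolding cond_C1_def
        by (intro frechet_subgradient_convex_global[OF _ g]) auto
      finally show "ereal (f y s - L s * norm (z - y)) \<le> fm y s z" .
    qed
  qed
  interpret stochastic_model_method P M X \<phi> f fm S \<alpha> x L \<delta> \<epsilon> K "diameter X"
  proof (rule stochastic_model_method.intro)
    show "norm (y - z) \<le> diameter X" if "y \<in> X" "z \<in> X" for y z
      using diameter_bounded_bound[OF bX that] by (simp add: dist_norm)
    show "convex_ereal (fm y s)" if "y \<in> X" "s \<in> space P" for y s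
      using assms(14) that unfolding cond_C1_def by blast
    show "fm y s y = ereal (f y s)" if "y \<in> X" "s \<in> space P" for y s
      using assms(15) that unfolding cond_C2_def by blast
    show "x k \<in> borel_measurable (past M P S k)" for k
      using assms(24) unfolding model_iteration_def by blast
    show "is_arg_min
          (\<lambda>y. fm (x k \<omega>) (S k \<omega>) y + ereal (\<phi> y) + ereal (1 / (2 * \<alpha> k) * (norm (y - x k \<omega>))\<^sup>2))
          (\<lambda>y. y \<in> X) (x (Suc k) \<omega>)" if "\<omega> \<in> space M" for k \<omega>
      using assms(24) that unfolding model_iteration_def by blast
  qed (fact assms L \<epsilon> \<delta> K lower up iterates)+
  obtain \<rho> where main: "AE \<omega> in M. convergent (\<lambda>k. objective P f \<phi> (x k \<omega>)) \<and>
    (\<forall>z r. strict_mono r \<and> (\<lambda>k. x (r k) \<omega>) \<longlonglongrightarrow> z \<longrightarrow>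
       z \<in> X \<and> (\<forall>y\<in>X. objective P f \<phi> z \<le> objective P f \<phi> y + \<rho> / 2 * (norm (y - z))\<^sup>2))"
    using objective_converges_and_limits_are_proximal by blast
  \<comment> \<open>A cluster point is its own proximal point; weak convexity of \<open>f\<close> turns this into stationarity.\<close>
  have stationary: "z \<in> stationary_set P X f \<phi>"
    if z: "z \<in> X" and min: "\<forall>y\<in>X. objective P f \<phi> z \<le> objective P f \<phi> y + \<rho> / 2 * (norm (y - z))\<^sup>2" for z
  proof -
    obtain e l where e: "e > 0" and cvx: "convex_on (cball z e) (\<lambda>y. mean_loss P f y + l / 2 * (norm (y - z))\<^sup>2)"
      using mean_loss_weakly_convex[OF assms(9,7) z] by blast
    have "mean_loss P f z + \<phi> z \<le> mean_loss P f y + \<phi> y + \<rho> / 2 * (norm (y - z))\<^sup>2" if "y \<in> X" for y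
      using min that unfolding objective_def by blast
    from stationary_of_proximal_minimizer[OF assms(4) z e cvx assms(5) this] z
    show ?thesis unfolding stationary_set_def by blast
  qed
  from main show ?thesis
    by eventually_elim (use stationary in \<open>auto simp: objective_def\<close>)
qed

end
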